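(* Let $n>4$ be an integer, let $H=C(n,n)$ be the set of all $n$-cycles in $S_n$, and let $\Gamma=\mathrm{Cay}(G,H)$, where $G=S_n$ when $n$ is even and $G=A_n$ when $n$ is odd. Then $\lambda_1(\Gamma)=(n-1)!$. Furthermore, $\lambda_2(\Gamma)=(n-2)!$ when $n$ is even and $\lambda_2(\Gamma)=2(n-3)!$ when $n$ is odd.
   Context: $S_n$ and $A_n$ are the symmetric and alternating groups on $\{1,\dots,n\}$. A $k$-cycle in $S_n$ is a permutation $(i_1,i_2,\dots,i_k)(i_{k+1})\cdots(i_n)$ with $i_1,\dots,i_k$ distinct, and $C(n,k)$ is the set of all $k$-cycles in $S_n$. For a finite group $G$, a subset $H\subset G$ is a connecting set if $1\notin H$, $H=H^{-1}=\{h^{-1}\mid h\in H\}$, and $H$ is not contained in any proper subgroup of $G$. For a connecting set $H$, the Cayley graph $\mathrm{Cay}(G,H)$ has vertex set $G$, with $u,v\in G$ adjacent if and only if $uv^{-1}\in H$. The eigenvalues of a graph are those of its adjacency matrix. The distinct eigenvalues of a graph $\Gamma$ are written $\lambda_1(\Gamma)>\lambda_2(\Gamma)>\cdots$, so $\lambda_1$ is the largest and $\lambda_2$ the second largest eigenvalue. *)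

theory Defs
  imports
    "HOL-Algebra.Sym_Groups"
    "Graph_Theory.Pair_Digraph"
    "Jordan_Normal_Form.Spectral_Radius"
begin

section \<open>Cayley graphs\<close>

definition connecting_set :: "('a, 'b) monoid_scheme \<Rightarrow> 'a set \<Rightarrow> bool" where
  "connecting_set G H \<longleftrightarrow>
     H \<subseteq> carrier G \<and> \<one>\<^bsub>G\<^esub> \<notin> H \<and> H = (\<lambda>h. inv\<^bsub>G\<^esub> h) ` H \<and>
     (\<forall>K. subgroup K G \<and> H \<subseteq> K \<longrightarrow> K = carrier G)"

text \<open>Undirected graphs are represented as symmetric digraphs. The definition makes sense
  for every \<open>H\<close>; it yields an undirected loop-free graph when \<open>H\<close> is a connecting set
  (lemma \<open>cayley_pair_graph\<close>).\<close>

definition Cay :: "('a, 'b) monoid_scheme \<Rightarrow> 'a set \<Rightarrow> 'a pair_pre_digraph" where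
  "Cay G H = \<lparr> pverts = carrier G,
     parcs = {(u, v). u \<in> carrier G \<and> v \<in> carrier G \<and> u \<otimes>\<^bsub>G\<^esub> inv\<^bsub>G\<^esub> v \<in> H} \<rparr>"

lemma cayley_pair_graph:
  assumes "group G" and "finite (carrier G)" and "connecting_set G H"
  shows "pair_graph (Cay G H)"
proof -
  interpret group G by fact
  have inv_H: "inv\<^bsub>G\<^esub> h \<in> H" if "h \<in> H" for h
    using assms(3) that unfolding connecting_set_def by blast
  have swap: "v \<otimes>\<^bsub>G\<^esub> inv\<^bsub>G\<^esub> u \<in> H"
    if "u \<in> carrier G" "v \<in> carrier G" "u \<otimes>\<^bsub>G\<^esub> inv\<^bsub>G\<^esub> v \<in> H" for u v
    using inv_H[OF that(3)] that(1,2) by (simp add: inv_mult_group)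
  show ?thesis
  proof unfold_locales
    show "finite (parcs (Cay G H))"
      by (rule finite_subset[of _ "carrier G \<times> carrier G"])
        (auto simp: Cay_def assms(2))
    show "symmetric (with_proj (Cay G H))"
      using swap by (auto simp: symmetric_def arcs_ends_def arc_to_ends_def with_proj_def
        Cay_def sym_def image_def)
    show "fst e \<noteq> snd e" if "e \<in> parcs (Cay G H)" for e
      using that assms(3) by (auto simp: Cay_def connecting_set_def)
  qed (auto simp: Cay_def assms(2))
qed


section \<open>Eigenvalues of a graph\<close>

text \<open>Matrices are indexed by natural numbers, so the adjacency matrix depends on an
  enumeration \<open>vs\<close> of the vertices. Its eigenvalues do not: see \<open>eigenvalue_adjacency_mat_cong\<close>.\<close>

definition adjacency_mat :: "'a pair_pre_digraph \<Rightarrow> 'a list \<Rightarrow> real mat" where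
  "adjacency_mat \<Gamma> vs = mat (length vs) (length vs)
     (\<lambda>(i, j). if (vs ! i, vs ! j) \<in> parcs \<Gamma> then 1 else 0)"

definition graph_eigenvalues :: "'a pair_pre_digraph \<Rightarrow> real set" where
  "graph_eigenvalues \<Gamma> =
     {x. \<exists>vs. distinct vs \<and> set vs = pverts \<Gamma> \<and> eigenvalue (adjacency_mat \<Gamma> vs) x}"

text \<open>The distinct eigenvalues in decreasing order, numbered from 1. When \<open>k\<close> is 0 or exceeds
  the number of distinct eigenvalues, \<open>graph_lambda \<Gamma> k\<close> is meaningless.\<close>

definition graph_lambda :: "'a pair_pre_digraph \<Rightarrow> nat \<Rightarrow> real" where
  "graph_lambda \<Gamma> k = rev (sorted_list_of_set (graph_eigenvalues \<Gamma>)) ! (k - 1)"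

lemma eigenvalue_adjacency_mat_iff:
  assumes "distinct vs"
  shows "eigenvalue (adjacency_mat \<Gamma> vs) x \<longleftrightarrow>
    (\<exists>f. (\<exists>v\<in>set vs. f v \<noteq> 0) \<and>
         (\<forall>u\<in>set vs. (\<Sum>v\<in>set vs. (if (u, v) \<in> parcs \<Gamma> then 1 else 0) * f v) = x * f u))"
    (is "?L \<longleftrightarrow> ?R")
proof -
  let ?n = "length vs" and ?A = "adjacency_mat \<Gamma> vs"
  let ?a = "\<lambda>u v. (if (u, v) \<in> parcs \<Gamma> then 1 else 0) :: real"
  have bij: "bij_betw (\<lambda>i. vs ! i) {0..<?n} (set vs)"
    using bij_betw_nth[OF assms, of "{0..<?n}" "set vs"] by (simp add: atLeast0LessThan)
  have row: "(?A *\<^sub>v w) $ i = (\<Sum>v\<in>set vs. ?a (vs ! i) v * f v)"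
    if "i < ?n" "w \<in> carrier_vec ?n" "\<And>j. j < ?n \<Longrightarrow> w $ j = f (vs ! j)" for w f i
  proof -
    have "(?A *\<^sub>v w) $ i = (\<Sum>j = 0..<?n. ?a (vs ! i) (vs ! j) * f (vs ! j))"
      using that by (simp add: adjacency_mat_def scalar_prod_def)
    also have "\<dots> = (\<Sum>v\<in>set vs. ?a (vs ! i) v * f v)"
      by (rule sum.reindex_bij_betw[OF bij])
    finally show ?thesis .
  qed
  have dims: "dim_row ?A = ?n" "dim_col ?A = ?n" by (auto simp: adjacency_mat_def)
  show ?thesis
  proof
    assume ?L
    then obtain w where w: "w \<in> carrier_vec ?n" "w \<noteq> 0\<^sub>v ?n" "?A *\<^sub>v w = x \<cdot>\<^sub>v w"
      by (auto simp: eigenvalue_def eigenvector_def dims)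
    define f where "f v = w $ (the_inv_into {0..<?n} (\<lambda>i. vs ! i) v)" for v
    have f: "w $ j = f (vs ! j)" if "j < ?n" for j
      using that bij by (simp add: f_def the_inv_into_f_f bij_betw_def)
    have "\<exists>j<?n. w $ j \<noteq> 0" using w(1,2) by auto
    hence "\<exists>v\<in>set vs. f v \<noteq> 0" using f by (metis nth_mem)
    moreover have "(\<Sum>v\<in>set vs. ?a u v * f v) = x * f u" if u: "u \<in> set vs" for u
    proof -
      obtain i where i: "i < ?n" "u = vs ! i" using u by (auto simp: in_set_conv_nth)
      show ?thesis using row[OF i(1) w(1) f] w i f by simp
    qed
    ultimately show ?R by blast
  next
    assume ?R
    then obtain f where f: "\<exists>v\<in>set vs. f v \<noteq> 0"
      "\<And>u. u \<in> set vs \<Longrightarrow> (\<Sum>v\<in>set vs. ?a u v * f v) = x * f u" by blast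
    define w where "w = vec ?n (\<lambda>j. f (vs ! j))"
    have w: "w \<in> carrier_vec ?n" "\<And>j. j < ?n \<Longrightarrow> w $ j = f (vs ! j)" by (auto simp: w_def)
    have "w \<noteq> 0\<^sub>v ?n" using f(1) w(2) by (metis in_set_conv_nth index_zero_vec(1))
    moreover have "?A *\<^sub>v w = x \<cdot>\<^sub>v w"
    proof (rule eq_vecI)
      fix i assume "i < dim_vec (x \<cdot>\<^sub>v w)"
      hence i: "i < ?n" using w(1) by simp
      show "(?A *\<^sub>v w) $ i = (x \<cdot>\<^sub>v w) $ i"
        using row[OF i w] f(2)[of "vs ! i"] i w by simp
    qed (use w(1) dims in auto)
    ultimately show ?L using w(1) by (auto simp: eigenvalue_def eigenvector_def dims)
  qed
qed

lemma eigenvalue_adjacency_mat_cong: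
  assumes "distinct vs" "distinct ws" "set vs = set ws"
  shows "eigenvalue (adjacency_mat \<Gamma> vs) x \<longleftrightarrow> eigenvalue (adjacency_mat \<Gamma> ws) x"
  using assms by (simp add: eigenvalue_adjacency_mat_iff)

lemma graph_eigenvalues_eq_spectrum:
  assumes "distinct vs" "set vs = pverts \<Gamma>"
  shows "graph_eigenvalues \<Gamma> = spectrum (adjacency_mat \<Gamma> vs)"
  using assms eigenvalue_adjacency_mat_cong[of _ vs \<Gamma>]
  by (auto simp: graph_eigenvalues_def spectrum_def)

lemma finite_graph_eigenvalues:
  assumes "finite (pverts \<Gamma>)"
  shows "finite (graph_eigenvalues \<Gamma>)"
proof -
  obtain vs where vs: "set vs = pverts \<Gamma>" "distinct vs"
    using finite_distinct_list[OF assms] by blast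
  have "adjacency_mat \<Gamma> vs \<in> carrier_mat (length vs) (length vs)"
    by (simp add: adjacency_mat_def)
  from card_finite_spectrum(1)[OF this] show ?thesis
    using graph_eigenvalues_eq_spectrum[OF vs(2,1)] by simp
qed


section \<open>Cycles in the symmetric group\<close>

definition k_cycles :: "nat \<Rightarrow> nat \<Rightarrow> (nat \<Rightarrow> nat) set" where
  "k_cycles n k = {cycle_of_list cs | cs. distinct cs \<and> length cs = k \<and> set cs \<subseteq> {1..n}}"

lemma k_cycles_permutes: "p \<in> k_cycles n k \<Longrightarrow> p permutes {1..n}"
  using cycle_permutes permutes_subset unfolding k_cycles_def by blast

lemma k_cycles_even:
  assumes "p \<in> k_cycles n k"
  shows "evenperm p \<longleftrightarrow> even (k - 1)"
proof -
  from assms obtain cs where cs: "p = cycle_of_list cs" "distinct cs" "length cs = k"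
    unfolding k_cycles_def by blast
  have "swapidseq (k - 1) p"
    using swapidseq_ext_imp_swapidseq[OF swapidseq_ext_of_cycles[OF cs(2)]] cs by simp
  thus ?thesis by (rule evenperm_unique) simp
qed

lemma cycle_of_list_rev:
  assumes "distinct cs"
  shows "cycle_of_list (rev cs) \<circ> cycle_of_list cs = id"
proof
  fix x
  let ?c = "cycle_of_list cs" and ?d = "cycle_of_list (rev cs)"
  show "(?d \<circ> ?c) x = id x"
  proof (cases "x \<in> set cs")
    case True
    let ?k = "length cs"
    have k: "?k > 0" using True by (cases cs) auto
    have c: "map ?c cs = rotate1 cs" using cyclic_rotation[OF assms, of 1] by simp
    have "map ?d (rev cs) = rotate1 (rev cs)"
      using cyclic_rotation[of "rev cs" 1] assms by simp
    hence "map ?d cs = rev (rotate1 (rev cs))" by (metis rev_map rev_rev_ident)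
    also have "\<dots> = rotate (?k - 1 mod ?k) cs" using rotate_rev[of 1 cs] by simp
    finally have d: "map ?d cs = rotate (?k - 1 mod ?k) cs" .
    have "map (?d \<circ> ?c) cs = map ?d (rotate1 cs)" by (simp flip: c)
    also have "\<dots> = rotate1 (map ?d cs)" by (simp add: rotate1_map)
    also have "\<dots> = rotate (Suc (?k - 1 mod ?k)) cs" by (simp add: d)
    also have "\<dots> = cs"
    proof (cases "?k = 1")
      case True
      then show ?thesis by (cases cs) auto
    next
      case False
      hence "Suc (?k - 1 mod ?k) = ?k" using k by simp
      thus ?thesis by simp
    qed
    finally have "map (?d \<circ> ?c) cs = map id cs" by simp
    thus ?thesis using True by (metis map_eq_conv)
  qed (simp add: id_outside_supp)
qed

lemma k_cycles_inv:
  assumes "p \<in> k_cycles n k"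
  shows "inv' p \<in> k_cycles n k"
proof -
  from assms obtain cs where cs: "p = cycle_of_list cs" "distinct cs" "length cs = k" "set cs \<subseteq> {1..n}"
    unfolding k_cycles_def by blast
  have "inv' p = cycle_of_list (rev cs)"
    using cycle_of_list_rev[of "rev cs"] cycle_of_list_rev[of cs] cs(1,2)
    by (intro inv_unique_comp) auto
  thus ?thesis unfolding k_cycles_def using cs by (intro CollectI exI[of _ "rev cs"]) auto
qed

lemma id_notin_k_cycles:
  assumes "k \<ge> 2"
  shows "id \<notin> k_cycles n k"
proof
  assume "id \<in> k_cycles n k"
  then obtain cs :: "nat list" where cs: "id = cycle_of_list cs" "distinct cs" "length cs = k"
    unfolding k_cycles_def by blast
  have "rotate1 cs = cs" using cyclic_rotation[OF cs(2), of 1] by (simp flip: cs(1))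
  moreover obtain a b r where "cs = a # b # r"
    using assms cs(3) by (metis One_nat_def Suc_1 Suc_le_length_iff)
  ultimately show False using cs(2) by simp
qed

lemma three_cycle_from_n_cycles:
  assumes "n \<ge> 4" "p \<in> three_cycles n"
  obtains s t where "s \<in> k_cycles n n" "t \<in> k_cycles n n" "p = t \<circ> inv' s"
proof -
  obtain cs where cs: "p = cycle_of_list cs" "distinct cs" "length cs = 3" "set cs \<subseteq> {1..n}"
    using assms(2) by blast
  obtain a b d where abd: "cs = [a, b, d]" using stupid_lemma[OF cs(3)] by blast
  have "card (set cs) < card {1..n}" using cs(2,3) assms(1) by (simp add: distinct_card)
  then obtain c where c: "c \<in> {1..n}" "c \<notin> set cs"
    by (metis card_mono finite_set leD subsetI)
  obtain r where r: "set r = {1..n} - {a, b, c, d}" "distinct r"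
    using finite_distinct_list[of "{1..n} - {a, b, c, d}"] by blast
  define s where "s = cycle_of_list (a # b # c # d # r)"
  define t where "t = cycle_of_list (b # c # a # d # r)"
  have dist: "distinct (a # b # c # d # r)" using c cs(2) r abd by auto
  have "{a, b, c, d} \<subseteq> {1..n}" using c(1) cs(4) unfolding abd by simp
  hence st: "set (a # b # c # d # r) = {1..n}" using r(1) by (simp only: list.set) blast
  hence len: "length (a # b # c # d # r) = n" using distinct_card[OF dist] by simp
  have "s \<in> k_cycles n n" unfolding k_cycles_def s_def
    using dist st len by blast
  moreover have "t \<in> k_cycles n n" unfolding k_cycles_def t_def
    using dist st len by (intro CollectI exI[of _ "b # c # a # d # r"]) auto
  moreover have "t = p \<circ> s"
  proof -
    have "transpose b c \<circ> transpose c a \<circ> transpose a d =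
      transpose a b \<circ> transpose b d \<circ> transpose a b \<circ> transpose b c \<circ> transpose c d"
      (is "?l = ?r")
    proof
      fix x
      have ne: "a \<noteq> b" "a \<noteq> c" "a \<noteq> d" "b \<noteq> c" "b \<noteq> d" "c \<noteq> d"
        using dist by auto
      consider "x = a" | "x = b" | "x = c" | "x = d" | "x \<notin> {a, b, c, d}" by blast
      thus "?l x = ?r x" using ne ne[symmetric]
        by cases (simp_all add: transpose_def)
    qed
    thus ?thesis unfolding s_def t_def cs(1) abd
      by (simp add: fun_eq_iff)
  qed
  hence "p = t \<circ> inv' s"
    using permutes_inv_o(1)[OF k_cycles_permutes[OF \<open>s \<in> k_cycles n n\<close>]]
    by (simp add: comp_assoc)
  ultimately show ?thesis using that by blast
qed

text \<open>The \<open>n\<close>-cycles form a connecting set of \<open>S\<^sub>n\<close> for \<open>n\<close> even and of \<open>A\<^sub>n\<close> for \<open>n\<close> odd.\<close>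

lemma connecting_set_n_cycles:
  assumes "n > 4"
  shows "connecting_set (if even n then sym_group n else alt_group n) (k_cycles n n)"
proof -
  let ?G = "if even n then sym_group n else alt_group n" and ?H = "k_cycles n n"
  have G: "group ?G" by (simp add: sym_group_is_group alt_group_is_group)
  have H: "?H \<subseteq> carrier ?G"
    using k_cycles_permutes[of _ n n] k_cycles_even[of _ n n] assms
    by (auto simp: sym_group_carrier alt_group_carrier)
  have mult: "mult ?G = (\<circ>)" by (simp add: sym_group_mult alt_group_mult)
  have m_inv: "inv\<^bsub>?G\<^esub> h = inv' h" if "h \<in> carrier ?G" for h
    using that alt_group_inv_equality[of h n] by (auto split: if_splits)
  have sub: "inv' h \<in> ?H" if "h \<in> ?H" for h using that by (rule k_cycles_inv)
  have img: "?H = (\<lambda>h. inv\<^bsub>?G\<^esub> h) ` ?H"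
  proof -
    have eq: "(\<lambda>h. inv\<^bsub>?G\<^esub> h) ` ?H = inv' ` ?H"
      using m_inv H by (intro image_cong) auto
    have "h \<in> inv' ` ?H" if "h \<in> ?H" for h
      using sub[OF that] permutes_inv_inv[OF k_cycles_permutes[OF that]] by (metis image_eqI)
    with sub show ?thesis unfolding eq by blast
  qed
  have gen: "K = carrier ?G" if K: "subgroup K ?G" "?H \<subseteq> K" for K
  proof -
    have three: "three_cycles n \<subseteq> K"
    proof
      fix p assume "p \<in> three_cycles n"
      then obtain s t where st: "s \<in> ?H" "t \<in> ?H" "p = t \<circ> inv' s"
        using three_cycle_from_n_cycles[of n p] assms by auto
      have "t \<otimes>\<^bsub>?G\<^esub> inv\<^bsub>?G\<^esub> s \<in> K"
        using K st by (blast intro: subgroup.m_closed subgroup.m_inv_closed)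
      thus "p \<in> K" using st m_inv[of s] H by (simp only: mult) auto
    qed
    have alt: "carrier (alt_group n) \<subseteq> K"
    proof -
      have "generate (alt_group n) (three_cycles n) = generate ?G (three_cycles n)"
        using group.generate_consistent[OF sym_group_is_group three_cycles_incl alt_group_is_subgroup]
        by (simp add: alt_group_def)
      thus ?thesis
        using group.generate_subgroup_incl[OF G three K(1)] alt_group_carrier_as_three_cycles by simp
    qed
    show ?thesis
    proof (cases "even n")
      case False
      thus ?thesis using alt K(1) subgroup.subset[OF K(1)] by auto
    next
      case True
      have "p \<in> K" if p: "p permutes {1..n}" for p
      proof (cases "evenperm p")
        case True
        thus ?thesis using p alt by (auto simp: alt_group_carrier)
      next
        case False
        have "cycle_of_list [1..<Suc n] \<in> ?H"
          unfolding k_cycles_def by (intro CollectI exI[of _ "[1..<Suc n]"]) auto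
        then obtain h where h: "h \<in> ?H" by blast
        have hp: "h permutes {1..n}" using h by (rule k_cycles_permutes)
        have "\<not> evenperm h" using k_cycles_even[OF h] \<open>even n\<close> assms by simp
        hence "evenperm (inv' h \<circ> p)"
          using False hp p by (simp add: evenperm_comp evenperm_inv permutation_permutes
            permutation_inverse permutes_inv) (metis evenperm_comp evenperm_inv finite_atLeastAtMost permutation_inverse permutation_permutes)
        hence "inv' h \<circ> p \<in> K"
          using alt hp p by (auto simp: alt_group_carrier permutes_compose permutes_inv)
        hence "h \<otimes>\<^bsub>?G\<^esub> (inv' h \<circ> p) \<in> K" using K h by (blast intro: subgroup.m_closed)
        moreover have "h \<circ> (inv' h \<circ> p) = p"
          using permutes_inv_o(1)[OF hp] by (simp flip: comp_assoc)
        ultimately show ?thesis by (simp only: mult)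
      qed
      thus ?thesis using \<open>even n\<close> subgroup.subset[OF K(1)] by (auto simp: sym_group_carrier)
    qed
  qed
  have one: "\<one>\<^bsub>?G\<^esub> \<notin> ?H"
    using id_notin_k_cycles[of n n] assms by (simp add: sym_group_one alt_group_one)
  show ?thesis unfolding connecting_set_def using H one img gen by blast
qed

end

theory Submission
  imports Defs "HOL-Combinatorics.Multiset_Permutations"
begin

text \<open>The spectrum of \<open>\<Gamma>\<close> is found inside the real group algebra, with explicit Young symmetrizers
  of hook shape in place of the character theory of the symmetric group. Let \<open>X = {1..n}\<close> and let
  \<open>A\<close> (\<open>cycle_op X\<close>) send a function \<open>f\<close> on permutations to
  \<open>u \<mapsto> \<Sum>h. f (h \<circ> u)\<close>, where \<open>h\<close> runs over the \<open>n\<close>-cycles. The adjacency operator of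
  \<open>\<Gamma>\<close> is the restriction of \<open>A\<close> to functions supported on \<open>G\<close>, and \<open>A\<close> commutes with the
  operators \<open>f \<mapsto> (u \<mapsto> f (g \<circ> u))\<close> for permutations \<open>g\<close> of \<open>X\<close>
  because the \<open>n\<close>-cycles form a conjugacy class.

  Three facts determine the eigenvalues of \<open>A\<close>. Write \<open>E T T'\<close> for the operator that
  antisymmetrizes over the permutations of \<open>T'\<close> and symmetrizes over those of \<open>T\<close>.

  \<^item> If \<open>T \<union> T' = X\<close> and \<open>T \<inter> T'\<close> is one point (a hook), then \<open>E T T'\<close> absorbs every
    permutation: inserting \<open>g\<close> between the two factors gives \<open>\<plusminus> E T T'\<close> or 0 (\<open>sandwich_hook\<close>).
    Hence \<open>E T T' \<circ> A = c \<cdot> E T T'\<close>, where \<open>c\<close> is the signed number of pairs \<open>(p, q)\<close> of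
    permutations of \<open>T\<close> and \<open>T'\<close> for which \<open>q \<circ> p\<close> is an \<open>n\<close>-cycle. That happens exactly when
    \<open>p\<close> and \<open>q\<close> are full cycles on \<open>T\<close> and \<open>T'\<close>, so \<open>c = (-1)^r r! (n-1-r)!\<close> with
    \<open>r = |T'| - 1\<close> (\<open>hook_symmetrizer_cycle_op\<close>).
  \<^item> \<open>n \<cdot> A = \<Sum>S\<subseteq>X. (-1)^|S| (n - |S|) E (X - S) S\<close> (\<open>cycle_op_expansion\<close>). A permutation
    \<open>g\<close> occurs on the right with the signed number of its invariant sets that avoid a point \<open>y\<close>,
    summed over \<open>y\<close>; each cycle contributes the sign \<open>-1\<close>, so adding or removing one cycle that
    does not contain \<open>y\<close> cancels everything unless \<open>g\<close> is a single cycle.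
  \<^item> \<open>n \<cdot> E (X - S) S\<close> is a sum of hook operators, obtained by enlarging one of the two sets by
    a point of the other (\<open>sandwich_complement_split\<close>).

  If \<open>A f = x f\<close> with \<open>x \<noteq> 0\<close> and \<open>f \<noteq> 0\<close>, the last two facts give a hook operator that does not
  annihilate \<open>f\<close>, and the first then forces \<open>x = (-1)^r r! (n-1-r)!\<close> for some \<open>r < n\<close>. Conversely
  the hook operator applied to the indicator function of the identity is an eigenfunction that does
  not vanish at the identity, so restricting it to \<open>A\<^sub>n\<close> keeps it non-zero. It remains to compare
  the numbers \<open>(-1)^r r! (n-1-r)!\<close>: the largest comes from \<open>r = 0\<close>, and the next from
  \<open>r = n - 2\<close> for even \<open>n\<close> and from \<open>r = 2\<close> for odd \<open>n\<close>.\<close>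

section \<open>Permutations that are a single cycle\<close>

text \<open>Full cycles are described by the absence of proper invariant subsets. This form passes easily to
  products (\<open>comp_single_cycles_iff\<close>) and to restrictions, and it agrees with
  \<^const>\<open>cycle_of_list\<close> by \<open>cycle_of_list_single\<close> and \<open>single_cycle_list\<close>.\<close>

definition single_cycles :: "'a set \<Rightarrow> ('a \<Rightarrow> 'a) set" where
  "single_cycles X = {p. p permutes X \<and> (\<forall>S\<subseteq>X. p ` S = S \<longrightarrow> S = {} \<or> S = X)}"

lemma single_cycles_permutes: "p \<in> single_cycles X \<Longrightarrow> p permutes X"
  by (simp add: single_cycles_def)

lemma finite_single_cycles: "finite X \<Longrightarrow> finite (single_cycles X)"
  by (rule finite_subset[OF _ finite_permutations[of X]]) (auto simp: single_cycles_def)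

text \<open>The complement of an invariant set is invariant, so it is enough to look at invariant sets that
  avoid one chosen point.\<close>

lemma single_cycles_iff:
  assumes "x \<in> X"
  shows "p \<in> single_cycles X \<longleftrightarrow> p permutes X \<and> (\<forall>S\<subseteq>X - {x}. p ` S = S \<longrightarrow> S = {})"
proof
  assume "p \<in> single_cycles X"
  then show "p permutes X \<and> (\<forall>S\<subseteq>X - {x}. p ` S = S \<longrightarrow> S = {})"
    using assms unfolding single_cycles_def by blast
next
  assume R: "p permutes X \<and> (\<forall>S\<subseteq>X - {x}. p ` S = S \<longrightarrow> S = {})"
  have "S = {} \<or> S = X" if S: "S \<subseteq> X" "p ` S = S" for S
  proof (cases "x \<in> S")
    case False
    with S R show ?thesis by blast
  next
    case True
    have "p ` (X - S) = p ` X - p ` S" using R by (intro image_set_diff permutes_inj) auto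
    then have "p ` (X - S) = X - S" using R S by (simp add: permutes_image)
    moreover have "X - S \<subseteq> X - {x}" using True by blast
    ultimately have "X - S = {}" using R by blast
    with S show ?thesis by blast
  qed
  with R show "p \<in> single_cycles X" by (simp add: single_cycles_def)
qed

lemma cycle_of_list_single:
  assumes "distinct cs"
  shows "cycle_of_list cs \<in> single_cycles (set cs)"
proof -
  let ?p = "cycle_of_list cs"
  have "S = set cs" if S: "S \<subseteq> set cs" "?p ` S = S" "S \<noteq> {}" for S
  proof -
    have pow: "(?p ^^ k) s \<in> S" if "s \<in> S" for s k
      using that S(2) by (induction k) auto
    obtain i where i: "i < length cs" "cs ! i \<in> S"
      using S(1,3) by (metis equals0I in_set_conv_nth subsetD)
    have "cs ! j \<in> S" if j: "j < length cs" for j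
    proof -
      \<comment> \<open>Rotating by \<open>j - i\<close>, shifted by the length to stay in the natural numbers.\<close>
      let ?k = "j + length cs - i"
      have "(?p ^^ ?k) (cs ! i) = rotate ?k cs ! i"
        using cyclic_rotation[OF assms, of ?k] i(1) by (metis nth_map)
      also have "\<dots> = cs ! ((?k + i) mod length cs)"
        using i(1) by (simp add: nth_rotate)
      also have "(?k + i) mod length cs = j" using i(1) j by simp
      finally show ?thesis using pow[OF i(2), of ?k] by simp
    qed
    then show ?thesis using S(1) by (metis in_set_conv_nth subsetI subset_antisym)
  qed
  then show ?thesis using cycle_permutes[of cs] by (auto simp: single_cycles_def)
qed

lemma single_cycle_list:
  assumes "finite X" "a \<in> X" "p \<in> single_cycles X"
  obtains cs where "distinct (a # cs)" "set (a # cs) = X" "p = cycle_of_list (a # cs)"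
proof -
  have p: "p permutes X" using assms(3) by (rule single_cycles_permutes)
  have perm: "permutation p" using p assms(1) by (auto simp: permutation_permutes)
  let ?cs = "support p a"
  have sub: "set ?cs \<subseteq> X"
    using permutes_in_image[OF permutes_funpow[OF p]] assms(2) by auto
  have "p ` set ?cs \<subseteq> set ?cs"
    unfolding support_set[OF perm] by (auto intro: range_eqI[of _ _ "Suc _"])
  then have inv: "p ` set ?cs = set ?cs"
    using permutes_inj_on[OF p] by (intro endo_inj_surj) auto
  have pos: "least_power p a > 0" by (rule least_power_of_permutation(2)[OF perm])
  have "set ?cs \<noteq> {}" using pos by simp
  then have X: "set ?cs = X" using assms(3) sub inv unfolding single_cycles_def by blast
  have p_eq: "p = cycle_of_list ?cs"
  proof
    fix b
    show "p b = cycle_of_list ?cs b"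
    proof (cases "b \<in> set ?cs")
      case True
      then show ?thesis by (rule cycle_restrict[OF perm])
    next
      case False
      then show ?thesis using X permutes_not_in[OF p] by (metis id_outside_supp)
    qed
  qed
  obtain ds where "?cs = a # ds" using pos by (simp add: upt_conv_Cons)
  then show ?thesis using that[of ds] cycle_of_permutation[OF perm, of a] X p_eq by simp
qed

text \<open>Starting the list at a fixed point \<open>a\<close> removes the freedom of rotating it: a cycle determines
  the rest of the list, which is an arbitrary ordering of \<open>X - {a}\<close>.\<close>

lemma card_single_cycles:
  assumes "finite X" "X \<noteq> {}"
  shows "card (single_cycles X) = fact (card X - 1)"
proof -
  obtain a where a: "a \<in> X" using assms(2) by blast
  have "bij_betw (\<lambda>cs. cycle_of_list (a # cs)) (permutations_of_set (X - {a})) (single_cycles X)"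
  proof (rule bij_betwI')
    fix as bs assume "as \<in> permutations_of_set (X - {a})" "bs \<in> permutations_of_set (X - {a})"
    then have d: "distinct (a # as)" "set as = X - {a}" "distinct (a # bs)" "set bs = X - {a}"
      by (auto simp: permutations_of_set_def)
    then have len: "length as = length bs" by (metis distinct.simps(2) distinct_card)
    show "(cycle_of_list (a # as) = cycle_of_list (a # bs)) = (as = bs)"
    proof
      assume eq: "cycle_of_list (a # as) = cycle_of_list (a # bs)"
      have nth: "(cycle_of_list cs ^^ i) (cs ! 0) = cs ! i" if "distinct cs" "i < length cs"
        for cs :: "'a list" and i
      proof -
        have "(cycle_of_list cs ^^ i) (cs ! 0) = rotate i cs ! 0"
          using cyclic_rotation[OF that(1), of i] that(2)
          by (metis length_greater_0_conv list.size(3) not_less_zero nth_map)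
        also have "\<dots> = cs ! i"
          using that(2) nth_rotate[of 0 cs i] by (cases cs) auto
        finally show ?thesis .
      qed
      have "(a # as) ! i = (a # bs) ! i" if "i < length (a # as)" for i
        using nth[OF d(1), of i] nth[OF d(3), of i] that len eq by simp
      then have "a # as = a # bs" using len by (intro nth_equalityI) auto
      then show "as = bs" by simp
    qed simp
  next
    fix cs assume "cs \<in> permutations_of_set (X - {a})"
    then have "distinct (a # cs)" "set (a # cs) = X"
      using a by (auto simp: permutations_of_set_def)
    then show "cycle_of_list (a # cs) \<in> single_cycles X" using cycle_of_list_single by metis
  next
    fix p assume "p \<in> single_cycles X"
    then obtain cs where "distinct (a # cs)" "set (a # cs) = X" "p = cycle_of_list (a # cs)"
      using single_cycle_list assms(1) a by metis
    then show "\<exists>cs\<in>permutations_of_set (X - {a}). p = cycle_of_list (a # cs)"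
      by (intro bexI[of _ cs]) (auto simp: permutations_of_set_def)
  qed
  then have "card (single_cycles X) = card (permutations_of_set (X - {a}))"
    by (simp add: bij_betw_same_card)
  then show ?thesis using assms(1) a by simp
qed

lemma sign_single_cycle:
  assumes "finite X" "X \<noteq> {}" "p \<in> single_cycles X"
  shows "sign p = (-1) ^ (card X - 1)"
proof -
  obtain a where a: "a \<in> X" using assms(2) by blast
  obtain cs where cs: "distinct (a # cs)" "set (a # cs) = X" "p = cycle_of_list (a # cs)"
    using single_cycle_list[OF assms(1) a assms(3)] by blast
  have "swapidseq (length (a # cs) - 1) p"
    using swapidseq_ext_imp_swapidseq[OF swapidseq_ext_of_cycles[OF cs(1)]] cs(3) by simp
  then have "evenperm p \<longleftrightarrow> even (length (a # cs) - 1)" by (rule evenperm_unique) simp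
  moreover have len: "card X = length (a # cs)" using distinct_card[OF cs(1)] cs(2) by simp
  ultimately show ?thesis by (simp add: sign_def len)
qed

lemma k_cycles_eq_single_cycles:
  assumes "n > 0"
  shows "k_cycles n n = single_cycles {1..n}"
proof
  show "k_cycles n n \<subseteq> single_cycles {1..n}"
  proof
    fix p assume "p \<in> k_cycles n n"
    then obtain cs where cs: "p = cycle_of_list cs" "distinct cs" "length cs = n" "set cs \<subseteq> {1..n}"
      unfolding k_cycles_def by blast
    then have "set cs = {1..n}" by (intro card_subset_eq) (auto simp: distinct_card)
    then show "p \<in> single_cycles {1..n}" using cycle_of_list_single cs by metis
  qed
next
  show "single_cycles {1..n} \<subseteq> k_cycles n n"
  proof
    fix p assume "p \<in> single_cycles {1..n}"
    then obtain cs where cs: "distinct (1 # cs)" "set (1 # cs) = {1..n}" "p = cycle_of_list (1 # cs)"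
      using single_cycle_list[of "{1..n}" 1 p] assms by auto
    moreover have "length (1 # cs) = n" using distinct_card[OF cs(1)] cs(2) by simp
    ultimately show "p \<in> k_cycles n n" unfolding k_cycles_def by blast
  qed
qed

text \<open>Conjugation by \<open>q\<close> permutes the full cycles; this is what makes their sum central.\<close>

lemma sum_single_cycles_commute:
  assumes "q permutes X"
  shows "(\<Sum>h\<in>single_cycles X. F (h \<circ> q)) = (\<Sum>h\<in>single_cycles X. F (q \<circ> h))"
proof (rule sum.reindex_bij_witness[of _ "\<lambda>h. q \<circ> h \<circ> inv' q" "\<lambda>h. inv' q \<circ> h \<circ> q"])
  have conj: "r \<circ> h \<circ> inv' r \<in> single_cycles X" if h: "h \<in> single_cycles X" and r: "r permutes X" for h r
  proof -
    have "S = {} \<or> S = X" if S: "S \<subseteq> X" "(r \<circ> h \<circ> inv' r) ` S = S" for S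
    proof -
      have "h ` (inv' r ` S) = inv' r ` ((r \<circ> h \<circ> inv' r) ` S)"
        by (simp add: image_comp comp_def permutes_inverses[OF r])
      then have "h ` (inv' r ` S) = inv' r ` S" by (simp only: S(2))
      moreover have "inv' r ` S \<subseteq> X"
        using S(1) permutes_image[OF permutes_inv[OF r]] by (metis image_mono)
      ultimately have "inv' r ` S = {} \<or> inv' r ` S = X"
        using h unfolding single_cycles_def by blast
      moreover have "S = r ` (inv' r ` S)"
        by (simp add: image_comp permutes_inv_o[OF r])
      ultimately show ?thesis using permutes_image[OF r] by auto
    qed
    moreover have "r \<circ> h \<circ> inv' r permutes X"
      using h r by (simp add: single_cycles_def permutes_compose permutes_inv)
    ultimately show ?thesis by (simp add: single_cycles_def)
  qed
  fix h assume h: "h \<in> single_cycles X"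
  show "q \<circ> (inv' q \<circ> h \<circ> q) \<circ> inv' q = h"
    by (simp add: fun_eq_iff permutes_inverses[OF assms])
  show "inv' q \<circ> h \<circ> q \<in> single_cycles X"
    using conj[OF h permutes_inv[OF assms]] by (simp add: permutes_inv_inv[OF assms])
  show "inv' q \<circ> (q \<circ> h \<circ> inv' q) \<circ> q = h"
    by (simp add: fun_eq_iff permutes_inverses[OF assms])
  show "q \<circ> h \<circ> inv' q \<in> single_cycles X" by (rule conj[OF h assms])
  show "F (q \<circ> (inv' q \<circ> h \<circ> q)) = F (h \<circ> q)"
    by (simp add: comp_assoc[symmetric] permutes_inv_o[OF assms])
qed

text \<open>Two cycles that meet in one point \<open>x\<close> multiply to a cycle on the union. Sets avoiding \<open>x\<close> that
  are invariant under one factor are fixed pointwise by the other, which gives one direction. For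
  the other direction, an invariant set of \<open>q \<circ> p\<close> that avoids \<open>x\<close> meets \<open>T'\<close> in an invariant
  set of \<open>q\<close>, hence not at all, and is then an invariant set of \<open>p\<close>.\<close>

lemma comp_single_cycles_iff:
  assumes "finite T" "finite T'" "T \<inter> T' = {x}" "p permutes T" "q permutes T'"
  shows "q \<circ> p \<in> single_cycles (T \<union> T') \<longleftrightarrow> p \<in> single_cycles T \<and> q \<in> single_cycles T'"
proof -
  have x: "x \<in> T" "x \<in> T'" "x \<in> T \<union> T'" using assms(3) by auto
  have qp: "q \<circ> p permutes T \<union> T'"
    using assms(4,5) by (intro permutes_compose) (auto intro: permutes_subset)
  show ?thesis
  proof
    assume L: "q \<circ> p \<in> single_cycles (T \<union> T')"
    have only: "S = {}" if "S \<subseteq> (T \<union> T') - {x}" "(q \<circ> p) ` S = S" for S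
      using L that single_cycles_iff[OF x(3)] by blast
    have "S = {}" if S: "S \<subseteq> T - {x}" "p ` S = S" for S
    proof (rule only)
      have "q s = s" if "s \<in> S" for s using that S(1) assms(3,5) by (intro permutes_not_in[of q T']) auto
      then show "(q \<circ> p) ` S = S" using S(2) by (metis image_comp image_cong image_ident)
    qed (use S in auto)
    moreover have "S = {}" if S: "S \<subseteq> T' - {x}" "q ` S = S" for S
    proof (rule only)
      have "p s = s" if "s \<in> S" for s using that S(1) assms(3,4) by (intro permutes_not_in[of p T]) auto
      then show "(q \<circ> p) ` S = S" using S(2) by (metis image_comp image_cong image_ident)
    qed (use S in auto)
    ultimately show "p \<in> single_cycles T \<and> q \<in> single_cycles T'"
      using assms(4,5) by (simp add: single_cycles_iff[OF x(1)] single_cycles_iff[OF x(2)])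
  next
    assume R: "p \<in> single_cycles T \<and> q \<in> single_cycles T'"
    have "S = {}" if S: "S \<subseteq> (T \<union> T') - {x}" "(q \<circ> p) ` S = S" for S
    proof -
      have fin: "finite S" using S(1) assms(1,2) by (meson finite_Diff finite_UnI finite_subset)
      have in_S: "q (p s) \<in> S" if "s \<in> S" for s using S(2) that by auto
      have "q ` (S \<inter> T') = S \<inter> T'"
      proof (rule endo_inj_surj)
        show "q ` (S \<inter> T') \<subseteq> S \<inter> T'"
        proof
          fix z assume "z \<in> q ` (S \<inter> T')"
          then obtain s where s: "s \<in> S" "s \<in> T'" "z = q s" by blast
          have "p s = s" using s S(1) assms(3,4) by (intro permutes_not_in[of p T]) auto
          then show "z \<in> S \<inter> T'" using in_S[OF s(1)] s permutes_in_image[OF assms(5)] by auto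
        qed
      qed (use fin permutes_inj_on[OF assms(5)] in auto)
      then have "S \<inter> T' = {}" using R S(1) single_cycles_iff[OF x(2)] by blast
      have "p ` S = S"
      proof (rule endo_inj_surj)
        show "p ` S \<subseteq> S"
        proof
          fix z assume "z \<in> p ` S"
          then obtain s where s: "s \<in> S" "z = p s" by blast
          then have "z \<in> T" using S(1) \<open>S \<inter> T' = {}\<close> permutes_in_image[OF assms(4)] by auto
          moreover have "z \<noteq> x"
          proof
            assume "z = x"
            then have "q x \<in> S" using in_S[OF s(1)] s by simp
            moreover have "q x \<in> T'" using x permutes_in_image[OF assms(5)] by simp
            ultimately show False using \<open>S \<inter> T' = {}\<close> by blast
          qed
          ultimately have "q z = z" using assms(3,5) by (intro permutes_not_in[of q T']) auto
          then show "z \<in> S" using in_S[OF s(1)] s by simp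
        qed
      qed (use fin permutes_inj_on[OF assms(4)] in auto)
      moreover have "S \<subseteq> T - {x}" using S(1) \<open>S \<inter> T' = {}\<close> by blast
      ultimately show "S = {}" using R single_cycles_iff[OF x(1)] by blast
    qed
    then show "q \<circ> p \<in> single_cycles (T \<union> T')" using qp by (simp add: single_cycles_iff[OF x(3)])
  qed
qed

lemma sign_on_Un:
  assumes "finite (S \<union> B)" "S \<inter> B = {}" "g ` S = S" "g ` B = B" "inj g"
  shows "sign_on (S \<union> B) g = sign_on S g * sign_on B g"
proof -
  have b: "bij_betw g S S" "bij_betw g B B"
    using assms(3,4,5) by (auto simp: bij_betw_def intro: inj_on_subset)
  have "restrict_id g (S \<union> B) = restrict_id g S \<circ> restrict_id g B"
    using assms(2,4) by (auto simp: restrict_id_def fun_eq_iff)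
  moreover have "permutation (restrict_id g S)" "permutation (restrict_id g B)"
    using permutes_restrict_id[OF b(1)] permutes_restrict_id[OF b(2)] assms(1)
    by (auto simp: permutation_permutes)
  ultimately show ?thesis by (simp add: sign_on_def sign_compose)
qed

text \<open>If \<open>g\<close> is not a full cycle, let \<open>B\<close> be a minimal invariant set that avoids \<open>y\<close>, that is, a cycle of
  \<open>g\<close>. The weight of \<open>B\<close> is \<open>-1\<close>, so \<open>S \<mapsto> S \<union> B\<close> pairs the invariant sets disjoint from \<open>B\<close>
  with those containing \<open>B\<close> and reverses the sign.\<close>

lemma signed_count_invariant_sets:
  assumes "finite X" "y \<in> X" "g permutes X"
  shows "(\<Sum>S | S \<subseteq> X - {y} \<and> g ` S = S. (-1) ^ card S * sign_on S g) =
    (if g \<in> single_cycles X then 1 else 0)"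
proof (cases "g \<in> single_cycles X")
  case True
  then have "{S. S \<subseteq> X - {y} \<and> g ` S = S} = {{}}"
    using single_cycles_iff[OF assms(2), of g] by auto
  then show ?thesis using True by (simp add: sign_on_def restrict_id_def)
next
  case False
  have inj: "inj g" using assms(3) by (rule permutes_inj)
  let ?I = "\<lambda>S. S \<subseteq> X - {y} \<and> g ` S = S"
  define w where "w S = (-1) ^ card S * sign_on S g" for S
  have "\<exists>S. ?I S \<and> S \<noteq> {}" using False assms(3) single_cycles_iff[OF assms(2), of g] by blast
  then obtain B where B: "?I B" "B \<noteq> {}"
    and min: "\<And>S. ?I S \<and> S \<noteq> {} \<Longrightarrow> card B \<le> card S"
    using ex_has_least_nat[of "\<lambda>S. ?I S \<and> S \<noteq> {}" _ card] by metis
  have finB: "finite B" using B(1) assms(1) by (meson finite_Diff finite_subset)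
  have dich: "S = {} \<or> S = B" if "S \<subseteq> B" "g ` S = S" for S
    using min[of S] B(1) that finB by (metis card_seteq order_trans)
  have "w B = -1"
  proof -
    have perm: "restrict_id g B permutes B"
      using B(1) inj by (intro permutes_restrict_id) (auto simp: bij_betw_def intro: inj_on_subset)
    have im: "restrict_id g B ` S = g ` S" if "S \<subseteq> B" for S
      using that by (intro image_cong) auto
    have "restrict_id g B \<in> single_cycles B"
      using perm dich im unfolding single_cycles_def by auto
    then have "sign_on B g = (-1) ^ (card B - 1)"
      using sign_single_cycle[OF finB B(2)] by (simp add: sign_on_def)
    moreover have "card B = Suc (card B - 1)" using finB B(2) by (simp add: card_gt_0_iff)
    ultimately show ?thesis unfolding w_def
      by (metis (no_types, lifting) minus_mult_left mult_minus1 power_Suc power_add power_minus1_even mult_2)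
  qed
  have w_Un: "w (S \<union> B) = - w S" if "?I S" "S \<inter> B = {}" for S
  proof -
    have fin: "finite S" using that(1) assms(1) by (meson finite_Diff finite_subset)
    have "w (S \<union> B) = w S * w B"
      using sign_on_Un[of S B g] fin finB that B(1) inj
      by (simp add: w_def card_Un_disjoint power_add)
    then show ?thesis by (simp add: \<open>w B = -1\<close>)
  qed
  let ?D = "{S. ?I S \<and> S \<inter> B = {}}" and ?E = "{S. ?I S \<and> B \<subseteq> S}"
  have fin: "finite {S. ?I S}" using assms(1) by simp
  have "{S. ?I S} = ?D \<union> ?E"
  proof -
    have "S \<inter> B = {} \<or> B \<subseteq> S" if "?I S" for S
    proof -
      have "g ` (S \<inter> B) = S \<inter> B" using that B(1) inj by (simp add: image_Int)
      then show ?thesis using dich[of "S \<inter> B"] by blast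
    qed
    then show ?thesis by blast
  qed
  then have "sum w {S. ?I S} = sum w ?D + sum w ?E"
    using B(2) by (simp only:) (rule sum.union_disjoint; use fin in auto)
  also have "sum w ?E = (\<Sum>S\<in>?D. w (S \<union> B))"
  proof (rule sum.reindex_bij_witness[of _ "\<lambda>S. S \<union> B" "\<lambda>S. S - B"])
    fix S assume "S \<in> ?E"
    then show "S - B \<in> ?D" using B(1) inj by (auto simp: image_set_diff)
  next
    fix S assume "S \<in> ?D"
    then show "S \<union> B \<in> ?E" using B(1) by (auto simp: image_Un)
  qed (auto intro: arg_cong[of _ _ w])
  also have "(\<Sum>S\<in>?D. w (S \<union> B)) = - sum w ?D"
    unfolding sum_negf[symmetric] by (rule sum.cong) (auto simp: w_Un)
  finally show ?thesis using False by (simp add: w_def)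
qed

section \<open>Symmetrizers of hook shape\<close>

text \<open>The operators act by left multiplication on the argument of \<open>f\<close>, so the operator that is applied
  last contributes the factor next to \<open>u\<close>. Functions live on all maps \<open>'a \<Rightarrow> 'a\<close>, so
  no carrier set appears in the identities between operators.\<close>

definition symmetrize :: "'a set \<Rightarrow> (('a \<Rightarrow> 'a) \<Rightarrow> real) \<Rightarrow> ('a \<Rightarrow> 'a) \<Rightarrow> real" where
  "symmetrize T f = (\<lambda>u. \<Sum>p | p permutes T. f (p \<circ> u))"

definition antisymmetrize :: "'a set \<Rightarrow> (('a \<Rightarrow> 'a) \<Rightarrow> real) \<Rightarrow> ('a \<Rightarrow> 'a) \<Rightarrow> real" where
  "antisymmetrize T f = (\<lambda>u. \<Sum>q | q permutes T. of_int (sign q) * f (q \<circ> u))"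

definition cycle_op :: "'a set \<Rightarrow> (('a \<Rightarrow> 'a) \<Rightarrow> real) \<Rightarrow> ('a \<Rightarrow> 'a) \<Rightarrow> real" where
  "cycle_op X f = (\<lambda>u. \<Sum>h\<in>single_cycles X. f (h \<circ> u))"

text \<open>The composite of \<^const>\<open>symmetrize\<close> and \<^const>\<open>antisymmetrize\<close> with a permutation \<open>g\<close> inserted
  between them, evaluated at \<open>f\<close> and \<open>u\<close>.\<close>

definition sandwich ::
  "'a set \<Rightarrow> 'a set \<Rightarrow> (('a \<Rightarrow> 'a) \<Rightarrow> real) \<Rightarrow> ('a \<Rightarrow> 'a) \<Rightarrow> ('a \<Rightarrow> 'a) \<Rightarrow> real" where
  "sandwich T T' f g u =
     (\<Sum>p | p permutes T. \<Sum>q | q permutes T'. of_int (sign q) * f (q \<circ> g \<circ> p \<circ> u))"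

lemma sandwich_id: "sandwich T T' f id u = symmetrize T (antisymmetrize T' f) u"
  by (simp add: sandwich_def symmetrize_def antisymmetrize_def comp_assoc)

lemma permutation_if_permutes: "finite T \<Longrightarrow> p permutes T \<Longrightarrow> permutation p"
  by (auto simp: permutation_permutes)

lemma sandwich_comp_right:
  assumes "p0 permutes T"
  shows "sandwich T T' f (g \<circ> p0) u = sandwich T T' f g u"
  unfolding sandwich_def
  by (subst (2) setum_permutations_compose_left[OF assms]) (simp add: comp_assoc)

lemma sandwich_comp_left:
  assumes "finite T'" "q0 permutes T'"
  shows "sandwich T T' f (q0 \<circ> g) u = of_int (sign q0) * sandwich T T' f g u"
proof -
  have "(\<Sum>q | q permutes T'. of_int (sign q) * f (q \<circ> g \<circ> v)) =
      of_int (sign q0) * (\<Sum>q | q permutes T'. of_int (sign q) * f (q \<circ> (q0 \<circ> g) \<circ> v))" for v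
  proof -
    have "(\<Sum>q | q permutes T'. of_int (sign q) * f (q \<circ> g \<circ> v)) =
        (\<Sum>q | q permutes T'. of_int (sign (q \<circ> q0)) * f (q \<circ> q0 \<circ> g \<circ> v))"
      by (rule sum_permutations_compose_right[OF assms(2)])
    also have "\<dots> = (\<Sum>q | q permutes T'. of_int (sign q0) * (of_int (sign q) * f (q \<circ> (q0 \<circ> g) \<circ> v)))"
      using assms permutation_if_permutes[OF assms(1)]
      by (intro sum.cong) (auto simp: sign_compose comp_assoc)
    finally show ?thesis by (simp add: sum_distrib_left)
  qed
  note * = this
  have "sandwich T T' f g u = of_int (sign q0) * sandwich T T' f (q0 \<circ> g) u"
    unfolding sandwich_def sum_distrib_left[of _ _ "{p. p permutes T}"]
    using *[of "_ \<circ> u"] by (simp add: comp_assoc)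
  moreover have "of_int (sign q0) * of_int (sign q0) = (1::real)"
    by (simp flip: of_int_mult)
  ultimately show ?thesis by (simp add: mult.assoc[symmetric])
qed

text \<open>A transposition inside \<open>T\<close> that \<open>g\<close> carries to one inside \<open>T'\<close> is absorbed with sign 1 on one
  side and with sign \<open>-1\<close> on the other.\<close>

lemma sandwich_eq_0:
  assumes "finite T'" "g permutes X" "a \<noteq> b" "g a \<in> T'" "g b \<in> T'" "a \<in> T" "b \<in> T"
  shows "sandwich T T' f g u = 0"
proof -
  let ?t = "transpose (g a) (g b)"
  have ne: "g a \<noteq> g b" using assms(2,3) by (metis permutes_inj inj_eq)
  have "?t \<circ> g = g \<circ> transpose a b"
    using assms(2) by (simp add: fun_eq_iff transpose_def) (metis permutes_inj inj_eq)
  moreover have "sandwich T T' f (g \<circ> transpose a b) u = sandwich T T' f g u"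
    using assms by (intro sandwich_comp_right permutes_swap_id)
  moreover have "sandwich T T' f (?t \<circ> g) u = - sandwich T T' f g u"
    using sandwich_comp_left[OF assms(1) permutes_swap_id[OF assms(4,5)]] ne
    by (simp add: sign_swap_id)
  ultimately show ?thesis by simp
qed

text \<open>The quotient of two factorizations permutes both \<open>T\<close> and \<open>T'\<close>, hence fixes everything outside
  one point.\<close>

lemma permutes_comp_unique:
  assumes "T \<inter> T' \<subseteq> {x}" "p permutes T" "p' permutes T" "q permutes T'" "q' permutes T'"
    and eq: "q \<circ> p = q' \<circ> p'"
  shows "q = q' \<and> p = p'"
proof -
  let ?r = "inv' q' \<circ> q"
  have "?r \<circ> p \<circ> inv' p = p' \<circ> inv' p"
    using eq permutes_inv_o[OF assms(5)] by (simp add: comp_assoc) (simp add: comp_assoc[symmetric])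
  then have r: "?r = p' \<circ> inv' p"
    using permutes_inv_o[OF assms(2)] by (simp add: comp_assoc)
  have "?r permutes T'" using assms by (intro permutes_compose permutes_inv)
  moreover have rT: "?r permutes T" unfolding r using assms by (intro permutes_compose permutes_inv)
  have "?r z = z" if "z \<in> T' - {x}" for z
    using that assms(1) by (intro permutes_not_in[OF rT]) auto
  ultimately have "?r permutes {x}" by (rule permutes_superset)
  then have id: "?r = id" by simp
  have "q' \<circ> ?r = q" using permutes_inv_o[OF assms(5)] by (simp add: comp_assoc[symmetric])
  then have q: "q = q'" using id by simp
  moreover have "inv' q \<circ> (q \<circ> p) = inv' q \<circ> (q \<circ> p')" using eq q by simp
  then have "p = p'" using permutes_inv_o[OF assms(4)] by (simp add: comp_assoc[symmetric])
  ultimately show ?thesis by simp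
qed

text \<open>By counting, some point \<open>a\<close> of \<open>T\<close> is mapped into \<open>T'\<close>, and by hypothesis only one. Following
  \<open>g\<close> with the transposition of \<open>g a\<close> and \<open>x\<close>, which is a permutation of \<open>T'\<close>, gives a map that
  preserves \<open>T\<close> and therefore splits.\<close>

lemma hook_factorization:
  assumes "finite T" "finite T'" "T \<inter> T' = {x}" "g permutes T \<union> T'"
    and one: "\<And>a b. a \<in> T \<Longrightarrow> b \<in> T \<Longrightarrow> g a \<in> T' \<Longrightarrow> g b \<in> T' \<Longrightarrow> a = b"
  obtains p q where "p permutes T" "q permutes T'" "g = q \<circ> p"
proof -
  have inj: "inj g" using assms(4) by (rule permutes_inj)
  have x: "x \<in> T" "x \<in> T'" using assms(3) by auto
  have "g ` T \<inter> T' \<noteq> {}"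
  proof
    assume "g ` T \<inter> T' = {}"
    moreover have "g ` T \<subseteq> T \<union> T'" using permutes_image[OF assms(4)] by blast
    ultimately have "g ` T \<subseteq> T - {x}" using assms(3) by blast
    then have "card (g ` T) \<le> card (T - {x})" using assms(1) by (intro card_mono) auto
    moreover have "card (g ` T) = card T" using inj by (intro card_image) (auto intro: inj_on_subset)
    moreover have "card (T - {x}) < card T" using assms(1) x(1) by (rule card_Diff1_less)
    ultimately show False by simp
  qed
  then obtain a where a: "a \<in> T" "g a \<in> T'" by blast
  let ?t = "transpose (g a) x"
  define k where "k = ?t \<circ> g"
  have t: "?t permutes T'" using a x by (intro permutes_swap_id)
  have k: "k permutes T \<union> T'" unfolding k_def
    using assms(4) t by (intro permutes_compose) (auto intro: permutes_subset)
  have kT: "k ` T = T"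
  proof (rule endo_inj_surj[OF assms(1)])
    show "k ` T \<subseteq> T"
    proof
      fix z assume "z \<in> k ` T"
      then obtain b where b: "b \<in> T" "z = k b" by blast
      show "z \<in> T"
      proof (cases "b = a")
        case True
        then show ?thesis using b x by (simp add: k_def)
      next
        case False
        then have "g b \<notin> T'" using one a b by blast
        then have "z = g b" using a x b by (auto simp: k_def transpose_def)
        then show ?thesis
          using \<open>g b \<notin> T'\<close> b(1) permutes_in_image[OF assms(4), of b] by blast
      qed
    qed
    show "inj_on k T" using permutes_inj_on[OF k] .
  qed
  let ?p = "restrict_id k T" and ?q = "restrict_id k (T' - T)"
  have compl: "k ` (T' - T) = T' - T"
  proof -
    have "k ` ((T \<union> T') - T) = k ` (T \<union> T') - k ` T"
      using permutes_inj[OF k] by (rule image_set_diff)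
    moreover have "(T \<union> T') - T = T' - T" by blast
    ultimately show ?thesis using kT permutes_image[OF k] by simp
  qed
  have p: "?p permutes T"
    using kT permutes_inj_on[OF k] by (intro permutes_restrict_id) (auto simp: bij_betw_def)
  have q: "?q permutes T' - T"
    using compl permutes_inj_on[OF k] by (intro permutes_restrict_id) (auto simp: bij_betw_def)
  have "k = ?q \<circ> ?p"
  proof
    fix z
    have "k z \<in> T" if "z \<in> T" using that kT by blast
    moreover have "k z = z" if "z \<notin> T \<union> T'" using that by (rule permutes_not_in[OF k])
    ultimately show "k z = (?q \<circ> ?p) z"
      by (cases "z \<in> T"; cases "z \<in> T'") (auto simp: restrict_id_def)
  qed
  then have "?t \<circ> k = (?t \<circ> ?q) \<circ> ?p" by (simp add: comp_assoc)
  moreover have "?t \<circ> k = g" by (simp add: k_def comp_assoc[symmetric])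
  moreover have "?t \<circ> ?q permutes T'"
    using t q by (intro permutes_compose) (auto intro: permutes_subset)
  ultimately show ?thesis using that[OF p, of "?t \<circ> ?q"] by simp
qed

text \<open>The hook case of von Neumann's lemma on Young symmetrizers. The sum on the right has at most one
  term, the sign of the unique \<open>q\<close> with \<open>g = q \<circ> p\<close>; it is empty exactly when two points of \<open>T\<close>
  are mapped into \<open>T'\<close>.\<close>

lemma sandwich_hook:
  assumes "finite T" "finite T'" "T \<inter> T' = {x}" "g permutes T \<union> T'"
  shows "sandwich T T' f g u =
    (\<Sum>(p, q) | p permutes T \<and> q permutes T' \<and> q \<circ> p = g. of_int (sign q)) * sandwich T T' f id u"
    (is "_ = sum _ ?P * _")
proof (cases "\<exists>p q. p permutes T \<and> q permutes T' \<and> q \<circ> p = g")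
  case True
  then obtain p q where pq: "p permutes T" "q permutes T'" "q \<circ> p = g" by blast
  have "?P = {(p, q)}"
  proof -
    have "p' = p \<and> q' = q" if "p' permutes T" "q' permutes T'" "q' \<circ> p' = g" for p' q'
      using permutes_comp_unique[of T T' x p' p q' q] that pq assms(3) by simp
    with pq show ?thesis by blast
  qed
  moreover have "sandwich T T' f g u = of_int (sign q) * sandwich T T' f id u"
    using sandwich_comp_left[OF assms(2) pq(2), of T f p u] sandwich_comp_right[OF pq(1), of T' f id u]
    by (simp add: pq(3))
  ultimately show ?thesis by simp
next
  case False
  then have empty: "?P = {}" by auto
  have "\<not> (\<forall>a\<in>T. \<forall>b\<in>T. g a \<in> T' \<longrightarrow> g b \<in> T' \<longrightarrow> a = b)"
  proof
    assume one: "\<forall>a\<in>T. \<forall>b\<in>T. g a \<in> T' \<longrightarrow> g b \<in> T' \<longrightarrow> a = b"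
    show False by (rule hook_factorization[OF assms]) (use one False in auto)
  qed
  then obtain a b where "a \<in> T" "b \<in> T" "g a \<in> T'" "g b \<in> T'" "a \<noteq> b"
    by blast
  then have "sandwich T T' f g u = 0" by (intro sandwich_eq_0[OF assms(2,4), of a b])
  then show ?thesis unfolding empty by simp
qed

text \<open>The scalar by which the sum of all \<open>n\<close>-cycles acts on the irreducible representation of hook shape
  \<open>(n - r, 1\<^sup>r)\<close>.\<close>

definition hook_value :: "nat \<Rightarrow> nat \<Rightarrow> real" where
  "hook_value n r = (-1) ^ r * fact r * fact (n - 1 - r)"

lemma sum_sign_hook_factors:
  assumes "finite T" "finite T'" "T \<inter> T' = {x}"
  shows "(\<Sum>h\<in>single_cycles (T \<union> T'). \<Sum>(p, q) | p permutes T \<and> q permutes T' \<and> q \<circ> p = h.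
      of_int (sign q)) = hook_value (card (T \<union> T')) (card T' - 1)"
proof -
  have ne: "T \<noteq> {}" "T' \<noteq> {}" using assms(3) by auto
  have fin: "finite {p. p permutes T}" "finite {q. q permutes T'}"
    using assms by (simp_all add: finite_permutations)
  have "(\<Sum>h\<in>single_cycles (T \<union> T'). \<Sum>(p, q) | p permutes T \<and> q permutes T' \<and> q \<circ> p = h.
      of_int (sign q) :: real) =
    (\<Sum>h\<in>single_cycles (T \<union> T'). \<Sum>y\<in>{y \<in> single_cycles T \<times> single_cycles T'. snd y \<circ> fst y = h}.
      of_int (sign (snd y)))"
  proof (intro sum.cong refl)
    fix h assume "h \<in> single_cycles (T \<union> T')"
    then show "{(p, q). p permutes T \<and> q permutes T' \<and> q \<circ> p = h} =
        {y \<in> single_cycles T \<times> single_cycles T'. snd y \<circ> fst y = h}"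
      using comp_single_cycles_iff[OF assms] by (auto simp: single_cycles_permutes)
  qed (auto simp: case_prod_unfold)
  also have "\<dots> = (\<Sum>y\<in>single_cycles T \<times> single_cycles T'. of_int (sign (snd y)))"
  proof (rule sum.group)
    show "(\<lambda>y. snd y \<circ> fst y) ` (single_cycles T \<times> single_cycles T') \<subseteq> single_cycles (T \<union> T')"
      using comp_single_cycles_iff[OF assms] by (auto simp: single_cycles_permutes)
  qed (use assms in \<open>auto simp: finite_single_cycles\<close>)
  also have "\<dots> = (\<Sum>y\<in>single_cycles T \<times> single_cycles T'. (-1) ^ (card T' - 1))"
    using sign_single_cycle[OF assms(2) ne(2)] by (intro sum.cong) auto
  also have "\<dots> = hook_value (card (T \<union> T')) (card T' - 1)"
  proof -
    have "card T > 0" "card T' > 0" using assms ne by (auto simp: card_gt_0_iff)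
    moreover have "card (T \<union> T') + 1 = card T + card T'"
      using card_Un_Int[OF assms(1,2)] assms(3) by simp
    ultimately have "card (T \<union> T') - 1 - (card T' - 1) = card T - 1" by linarith
    then show ?thesis
      using assms ne by (simp add: hook_value_def card_single_cycles card_cartesian_product)
  qed
  finally show ?thesis .
qed

text \<open>By centrality the cycle may be moved between the antisymmetrizer and the symmetrizer, where
  \<open>sandwich_hook\<close> turns it into a scalar.\<close>

lemma hook_symmetrizer_cycle_op:
  assumes "finite T" "finite T'" "T \<inter> T' = {x}"
  shows "symmetrize T (antisymmetrize T' (cycle_op (T \<union> T') f)) u =
    hook_value (card (T \<union> T')) (card T' - 1) * symmetrize T (antisymmetrize T' f) u"
proof -
  let ?H = "single_cycles (T \<union> T')"
  have "(\<Sum>h\<in>?H. f (h \<circ> q \<circ> v)) = (\<Sum>h\<in>?H. f (q \<circ> h \<circ> v))" if "q permutes T'" for q v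
  proof -
    have "q permutes T \<union> T'" using that by (rule permutes_subset) blast
    from sum_single_cycles_commute[OF this, of "\<lambda>h. f (h \<circ> v)"] show ?thesis .
  qed
  then have "symmetrize T (antisymmetrize T' (cycle_op (T \<union> T') f)) u =
      (\<Sum>p | p permutes T. \<Sum>q | q permutes T'. of_int (sign q) * (\<Sum>h\<in>?H. f (q \<circ> h \<circ> (p \<circ> u))))"
    unfolding symmetrize_def antisymmetrize_def cycle_op_def
    by (intro sum.cong refl) (simp add: comp_assoc)
  also have "\<dots> = (\<Sum>p | p permutes T. \<Sum>q | q permutes T'. \<Sum>h\<in>?H.
      of_int (sign q) * f (q \<circ> h \<circ> p \<circ> u))"
    by (simp add: sum_distrib_left comp_assoc)
  also have "\<dots> = (\<Sum>h\<in>?H. sandwich T T' f h u)"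
    unfolding sandwich_def by (subst (2) sum.swap, subst sum.swap) simp
  also have "\<dots> = (\<Sum>h\<in>?H. (\<Sum>(p, q) | p permutes T \<and> q permutes T' \<and> q \<circ> p = h.
      of_int (sign q)) * sandwich T T' f id u)"
    by (intro sum.cong refl sandwich_hook[OF assms] single_cycles_permutes)
  also have "\<dots> = hook_value (card (T \<union> T')) (card T' - 1) * sandwich T T' f id u"
    by (simp only: sum_distrib_right[symmetric] sum_sign_hook_factors[OF assms])
  finally show ?thesis by (simp add: sandwich_id)
qed

section \<open>Expanding the sum of full cycles in hook operators\<close>

lemma sandwich_insert_left:
  assumes "finite T" "y \<notin> T"
  shows "sandwich (insert y T) S f id u = (\<Sum>s\<in>insert y T. sandwich T S f (transpose y s) u)"
  unfolding sandwich_def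
  by (subst sum_over_permutations_insert[OF assms]) (simp add: comp_assoc)

lemma sandwich_insert_right:
  assumes "finite S" "x \<notin> S"
  shows "sandwich T (insert x S) f id u =
    (\<Sum>s\<in>insert x S. of_int (sign (transpose x s)) * sandwich T S f (transpose x s) u)"
proof -
  have "(\<Sum>q | q permutes insert x S. of_int (sign q) * f (q \<circ> v)) =
      (\<Sum>s\<in>insert x S. \<Sum>q | q permutes S.
        of_int (sign (transpose x s)) * (of_int (sign q) * f (q \<circ> transpose x s \<circ> v)))" for v
  proof -
    let ?G = "\<lambda>q. of_int (sign q) * f (q \<circ> v)"
    have "sum ?G {q. q permutes insert x S} = (\<Sum>q | q permutes insert x S. ?G (inv' q))"
      by (rule sum_permutations_inverse)
    also have "\<dots> = (\<Sum>s\<in>insert x S. \<Sum>q | q permutes S. ?G (inv' (transpose x s \<circ> q)))"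
      by (rule sum_over_permutations_insert[OF assms])
    also have "\<dots> = (\<Sum>s\<in>insert x S. \<Sum>q | q permutes S. ?G (inv' q \<circ> transpose x s))"
      by (intro sum.cong refl) (simp add: o_inv_distrib permutes_bij)
    also have "\<dots> = (\<Sum>s\<in>insert x S. \<Sum>q | q permutes S. ?G (q \<circ> transpose x s))"
      by (intro sum.cong refl sum_permutations_inverse[symmetric])
    also have "\<dots> = (\<Sum>s\<in>insert x S. \<Sum>q | q permutes S.
        of_int (sign (transpose x s)) * (of_int (sign q) * f (q \<circ> transpose x s \<circ> v)))"
      using permutation_if_permutes[OF assms(1)]
      by (intro sum.cong refl) (simp add: sign_compose permutation_swap_id)
    finally show ?thesis .
  qed
  note * = this
  have "sandwich T (insert x S) f id u = (\<Sum>p | p permutes T. \<Sum>s\<in>insert x S. \<Sum>q | q permutes S.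
        of_int (sign (transpose x s)) * (of_int (sign q) * f (q \<circ> transpose x s \<circ> (p \<circ> u))))"
    unfolding sandwich_def
  proof (intro sum.cong refl)
    fix p
    show "(\<Sum>q | q permutes insert x S. of_int (sign q) * f (q \<circ> id \<circ> p \<circ> u)) =
        (\<Sum>s\<in>insert x S. \<Sum>q | q permutes S.
          of_int (sign (transpose x s)) * (of_int (sign q) * f (q \<circ> transpose x s \<circ> (p \<circ> u))))"
      using *[of "p \<circ> u"] by (simp only: comp_assoc id_comp)
  qed
  also have "\<dots> = (\<Sum>s\<in>insert x S. of_int (sign (transpose x s)) * sandwich T S f (transpose x s) u)"
    unfolding sandwich_def by (subst sum.swap) (simp add: sum_distrib_left comp_assoc)
  finally show ?thesis .
qed

text \<open>In each summand, decompose the symmetric group of the enlarged set into cosets of the original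
  one. The terms with the transposition \<open>(x y)\<close>, where \<open>x \<in> X - S\<close> and \<open>y \<in> S\<close>, have sign \<open>-1\<close> in
  the first sum and sign 1 in the second, so they cancel. What remains is the identity term, once
  for every point of \<open>X\<close>.\<close>

lemma sandwich_complement_split:
  assumes "finite X" "S \<subseteq> X"
  shows "real (card X) * sandwich (X - S) S f id u =
    (\<Sum>x\<in>X - S. sandwich (X - S) (insert x S) f id u) +
    (\<Sum>y\<in>S. sandwich (insert y (X - S)) S f id u)"
proof -
  let ?T = "X - S" and ?D = "\<lambda>g. sandwich (X - S) S f g u"
  have fin: "finite S" "finite ?T" using assms by (auto intro: finite_subset)
  have 1: "sandwich ?T (insert x S) f id u = ?D id - (\<Sum>s\<in>S. ?D (transpose x s))" if "x \<in> ?T" for x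
  proof -
    have "x \<notin> S" using that by blast
    moreover have "(\<Sum>s\<in>S. of_int (sign (transpose x s)) * ?D (transpose x s)) =
        (\<Sum>s\<in>S. - ?D (transpose x s))"
      using \<open>x \<notin> S\<close> by (intro sum.cong) (auto simp: sign_swap_id)
    ultimately show ?thesis
      using fin by (simp add: sandwich_insert_right sum_negf)
  qed
  have 2: "sandwich (insert y ?T) S f id u = ?D id + (\<Sum>x\<in>?T. ?D (transpose x y))" if "y \<in> S" for y
    using that fin by (simp add: sandwich_insert_left transpose_commute)
  have "(\<Sum>x\<in>?T. sandwich ?T (insert x S) f id u) + (\<Sum>y\<in>S. sandwich (insert y ?T) S f id u) =
      (real (card ?T) + real (card S)) * ?D id"
    using sum.swap[of "\<lambda>x y. ?D (transpose x y)" S ?T]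
    by (simp add: 1 2 sum_subtractf sum.distrib algebra_simps)
  also have "real (card ?T) + real (card S) = real (card X)"
    using assms fin by (metis add.commute card_Diff_subset card_mono le_add_diff_inverse of_nat_add)
  finally show ?thesis by (rule sym)
qed

text \<open>For disjoint sets the products \<open>q \<circ> p\<close> are the permutations of \<open>X\<close> that preserve \<open>S\<close>, each
  obtained once.\<close>

lemma sandwich_complement:
  assumes "finite X" "S \<subseteq> X"
  shows "sandwich (X - S) S f id u =
    (\<Sum>g | g permutes X \<and> g ` S = S. of_int (sign_on S g) * f (g \<circ> u))"
proof -
  let ?A = "{p. p permutes X - S} \<times> {q. q permutes S}"
  have "sandwich (X - S) S f id u = (\<Sum>(p, q)\<in>?A. of_int (sign q) * f (q \<circ> p \<circ> u))"
    by (simp add: sandwich_def sum.cartesian_product)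
  also have "\<dots> = (\<Sum>g | g permutes X \<and> g ` S = S. of_int (sign_on S g) * f (g \<circ> u))"
  proof (rule sum.reindex_bij_witness[of _ "\<lambda>g. (restrict_id g (X - S), restrict_id g S)"
        "\<lambda>(p, q). q \<circ> p"])
    fix a assume "a \<in> ?A"
    then obtain p q where a: "a = (p, q)" and pq: "p permutes X - S" "q permutes S" by auto
    have p: "p s = s" if "s \<in> S" for s using that by (intro permutes_not_in[OF pq(1)]) auto
    have q: "q (p s) = p s" if "s \<notin> S" for s
    proof (intro permutes_not_in[OF pq(2)] notI)
      assume "p s \<in> S"
      then have "p (p s) = p s" by (rule p)
      then have "p s = s" using permutes_inj[OF pq(1)] by (simp add: inj_eq)
      then show False using that \<open>p s \<in> S\<close> by simp
    qed
    have r1: "restrict_id (q \<circ> p) S = q"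
      using p permutes_not_in[OF pq(2)] by (auto simp: restrict_id_def fun_eq_iff)
    have r2: "restrict_id (q \<circ> p) (X - S) = p"
      using p q permutes_not_in[OF pq(1)] by (auto simp: restrict_id_def fun_eq_iff)
    show "(restrict_id (case a of (p, q) \<Rightarrow> q \<circ> p) (X - S),
        restrict_id (case a of (p, q) \<Rightarrow> q \<circ> p) S) = a"
      by (simp only: a prod.case r1 r2)
    show "(case a of (p, q) \<Rightarrow> q \<circ> p) \<in> {g. g permutes X \<and> g ` S = S}"
    proof -
      have "(q \<circ> p) ` S = q ` S" using p by (intro image_cong) auto
      moreover have "q \<circ> p permutes X"
        using assms(2) pq by (intro permutes_compose) (auto intro: permutes_subset)
      ultimately show ?thesis using permutes_image[OF pq(2)] by (simp add: a)
    qed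
    show "of_int (sign_on S (case a of (p, q) \<Rightarrow> q \<circ> p)) * f ((case a of (p, q) \<Rightarrow> q \<circ> p) \<circ> u) =
        (case a of (p, q) \<Rightarrow> of_int (sign q) * f (q \<circ> p \<circ> u))"
      by (simp only: a prod.case sign_on_def r1)
  next
    fix g assume "g \<in> {g. g permutes X \<and> g ` S = S}"
    then have g: "g permutes X" "g ` S = S" by auto
    have gc: "g ` (X - S) = X - S"
      using image_set_diff[OF permutes_inj[OF g(1)], of X S] permutes_image[OF g(1)] g(2) by simp
    show "(case (restrict_id g (X - S), restrict_id g S) of (p, q) \<Rightarrow> q \<circ> p) = g"
    proof -
      have "g s \<in> X - S" if "s \<in> X - S" for s using gc that by blast
      moreover have "g s = s" if "s \<notin> X" for s using that by (rule permutes_not_in[OF g(1)])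
      ultimately show ?thesis using assms(2) by (auto simp: restrict_id_def fun_eq_iff)
    qed
    show "(restrict_id g (X - S), restrict_id g S) \<in> ?A"
      using g(2) gc permutes_inj_on[OF g(1)] by (auto intro!: permutes_restrict_id simp: bij_betw_def)
  qed
  finally show ?thesis .
qed

text \<open>The factor \<open>card (X - S)\<close> is written as a sum over the points \<open>y \<notin> S\<close>. After exchanging the sums,
  every \<open>y \<in> X\<close> selects the full cycles by \<open>signed_count_invariant_sets\<close>.\<close>

lemma cycle_op_expansion:
  assumes "finite X"
  shows "real (card X) * cycle_op X f u =
    (\<Sum>S\<in>Pow X. (-1) ^ card S * real (card (X - S)) * sandwich (X - S) S f id u)"
proof -
  let ?P = "{g. g permutes X}"
  let ?w = "\<lambda>S g. (-1) ^ card S * sign_on S g"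
  let ?c = "\<lambda>S g y. if y \<notin> S \<and> g ` S = S then of_int (?w S g) * f (g \<circ> u) else 0"
  have finP: "finite ?P" using assms by (rule finite_permutations)
  have "(\<Sum>S\<in>Pow X. (-1) ^ card S * real (card (X - S)) * sandwich (X - S) S f id u) =
      (\<Sum>S\<in>Pow X. \<Sum>y\<in>X. \<Sum>g\<in>?P. ?c S g y)"
  proof (intro sum.cong refl)
    fix S assume "S \<in> Pow X"
    then have S: "S \<subseteq> X" by simp
    have "(\<Sum>y\<in>X. \<Sum>g\<in>?P. ?c S g y) =
        (\<Sum>y\<in>X. if y \<notin> S then (\<Sum>g\<in>?P. if g ` S = S then of_int (?w S g) * f (g \<circ> u) else 0) else 0)"
      by (intro sum.cong) auto
    also have "\<dots> = (\<Sum>y\<in>X - S. (\<Sum>g\<in>?P. if g ` S = S then of_int (?w S g) * f (g \<circ> u) else 0))"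
      using assms by (intro sum.mono_neutral_cong_right) auto
    also have "(\<Sum>g\<in>?P. if g ` S = S then of_int (?w S g) * f (g \<circ> u) else 0) =
        (\<Sum>g | g permutes X \<and> g ` S = S. of_int (?w S g) * f (g \<circ> u))"
      using finP by (intro sum.mono_neutral_cong_right) auto
    also have "\<dots> = (-1) ^ card S * sandwich (X - S) S f id u"
      by (simp add: sandwich_complement[OF assms S] sum_distrib_left mult.assoc)
    finally show "(-1) ^ card S * real (card (X - S)) * sandwich (X - S) S f id u =
        (\<Sum>y\<in>X. \<Sum>g\<in>?P. ?c S g y)" by simp
  qed
  also have "\<dots> = (\<Sum>y\<in>X. \<Sum>g\<in>?P. \<Sum>S\<in>Pow X. ?c S g y)"
    by (subst sum.swap, intro sum.cong refl, rule sum.swap)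
  also have "\<dots> = (\<Sum>y\<in>X. \<Sum>g\<in>?P. if g \<in> single_cycles X then f (g \<circ> u) else 0)"
  proof (intro sum.cong refl)
    fix y g assume y: "y \<in> X" and "g \<in> ?P"
    then have g: "g permutes X" by simp
    have "(\<Sum>S\<in>Pow X. ?c S g y) =
        (\<Sum>S | S \<subseteq> X - {y} \<and> g ` S = S. of_int (?w S g) * f (g \<circ> u))"
      using assms by (intro sum.mono_neutral_cong_right) auto
    also have "\<dots> = of_int (\<Sum>S | S \<subseteq> X - {y} \<and> g ` S = S. ?w S g) * f (g \<circ> u)"
      by (simp add: sum_distrib_right)
    finally show "(\<Sum>S\<in>Pow X. ?c S g y) = (if g \<in> single_cycles X then f (g \<circ> u) else 0)"
      by (simp only: signed_count_invariant_sets[OF assms y g]) simp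
  qed
  also have "(\<Sum>g\<in>?P. if g \<in> single_cycles X then f (g \<circ> u) else 0) = cycle_op X f u"
    unfolding cycle_op_def using finP single_cycles_permutes
    by (intro sum.mono_neutral_cong_right) auto
  also have "(\<Sum>y\<in>X. cycle_op X f u) = real (card X) * cycle_op X f u" by simp
  finally show ?thesis by (rule sym)
qed

section \<open>Eigenvalues of the cycle operator\<close>

text \<open>Every non-zero eigenvalue is seen by some hook operator, since \<open>cycle_op X f\<close> is a combination of
  hook operators applied to \<open>f\<close>.\<close>

lemma cycle_op_eigenvalue:
  assumes "finite X" and eigen: "cycle_op X f = (\<lambda>u. x * f u)" and "f u \<noteq> 0" "x \<noteq> 0" "X \<noteq> {}"
  shows "\<exists>r<card X. x = hook_value (card X) r"
proof -
  have hook: "\<exists>r<card X. x = hook_value (card X) r"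
    if "T \<union> T' = X" "T \<inter> T' = {z}" "sandwich T T' f id u \<noteq> 0" for T T' z
  proof -
    have fin: "finite T" "finite T'" using that(1) assms(1) by auto
    have "x * symmetrize T (antisymmetrize T' f) u =
        symmetrize T (antisymmetrize T' (cycle_op (T \<union> T') f)) u"
      by (simp add: that(1) eigen symmetrize_def antisymmetrize_def sum_distrib_left mult.left_commute)
    also have "\<dots> = hook_value (card X) (card T' - 1) * symmetrize T (antisymmetrize T' f) u"
      using hook_symmetrizer_cycle_op[OF fin that(2)] that(1) by simp
    finally have "x = hook_value (card X) (card T' - 1)"
      using that(3) by (simp add: sandwich_id)
    moreover have "card T' - 1 < card X"
    proof -
      have "card T' \<le> card X" using that(1) assms(1) by (intro card_mono) auto
      moreover have "card X > 0" using assms(1,5) by (simp add: card_gt_0_iff)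
      ultimately show ?thesis by linarith
    qed
    ultimately show ?thesis by blast
  qed
  have "real (card X) * cycle_op X f u \<noteq> 0"
    using assms by (simp add: eigen)
  then obtain S where S: "S \<subseteq> X" "sandwich (X - S) S f id u \<noteq> 0"
    unfolding cycle_op_expansion[OF assms(1)] by (metis (no_types, lifting) PowD mult_zero_right sum.neutral)
  then have "real (card X) * sandwich (X - S) S f id u \<noteq> 0" using assms by simp
  then consider y where "y \<in> X - S" "sandwich (X - S) (insert y S) f id u \<noteq> 0"
    | y where "y \<in> S" "sandwich (insert y (X - S)) S f id u \<noteq> 0"
    unfolding sandwich_complement_split[OF assms(1) S(1)]
    by (metis (no_types, lifting) add.right_neutral sum.neutral)
  then show ?thesis
  proof cases
    case 1
    then show ?thesis using S(1) by (intro hook[of "X - S" "insert y S" y]) auto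
  next
    case 2
    then show ?thesis using S(1) by (intro hook[of "insert y (X - S)" S y]) auto
  qed
qed

text \<open>The eigenfunction is the Young symmetrizer itself, regarded as a function on permutations. Its
  value at the identity is 1 because only \<open>p = q = id\<close> contributes. It is required to be non-zero
  there, and not just somewhere, so that its restriction to the even permutations is non-zero.\<close>

lemma cycle_op_eigenfunction:
  assumes "finite X" "r < card X"
  obtains f where "f id \<noteq> 0" "cycle_op X f = (\<lambda>u. hook_value (card X) r * f u)"
proof -
  obtain T' where T': "T' \<subseteq> X" "card T' = Suc r" "finite T'"
    using obtain_subset_with_card_n[of "Suc r" X] assms(2) by (metis Suc_leI)
  then obtain x where x: "x \<in> T'" by fastforce
  \<comment> \<open>A hook with \<open>r + 1\<close> points in the antisymmetrized part.\<close>
  define T where "T = insert x (X - T')"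
  have T: "finite T" "T \<inter> T' = {x}" "T \<union> T' = X" using assms(1) T' x by (auto simp: T_def)
  define e :: "('a \<Rightarrow> 'a) \<Rightarrow> real" where "e u = (if u = id then 1 else 0)" for u
  define f where "f = symmetrize T (antisymmetrize T' e)"
  have f: "f u = (\<Sum>p | p permutes T. \<Sum>q | q permutes T'. of_int (sign q) * e (q \<circ> p \<circ> u))" for u
    by (simp add: f_def symmetrize_def antisymmetrize_def comp_assoc)
  have fin: "finite {p. p permutes T}" "finite {q. q permutes T'}"
    using T(1) T'(3) by (simp_all add: finite_permutations)
  have "f id = (\<Sum>p | p permutes T. \<Sum>q | q permutes T'. if p = id then (if q = id then 1 else 0) else 0)"
    unfolding f
  proof (intro sum.cong refl)
    fix p q assume "p \<in> {p. p permutes T}" "q \<in> {q. q permutes T'}"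
    then have "q \<circ> p = id \<longleftrightarrow> p = id \<and> q = id"
      using permutes_comp_unique[of T T' x p id q id] T(2) by auto
    then show "of_int (sign q) * e (q \<circ> p \<circ> id) = (if p = id then (if q = id then 1 else 0) else 0)"
      by (auto simp: e_def)
  qed
  also have "\<dots> = 1" using fin by (simp add: sum.delta if_distrib[of "sum _"] sum.If_cases)
  finally have "f id \<noteq> 0" by simp
  moreover have "cycle_op X f u = hook_value (card X) r * f u" for u
  proof -
    let ?H = "single_cycles X"
    have "cycle_op X f u = (\<Sum>p | p permutes T. \<Sum>h\<in>?H. \<Sum>q | q permutes T'.
        of_int (sign q) * e (q \<circ> p \<circ> (h \<circ> u)))"
      unfolding cycle_op_def f by (rule sum.swap)
    also have "\<dots> = (\<Sum>p | p permutes T. \<Sum>q | q permutes T'. \<Sum>h\<in>?H.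
        of_int (sign q) * e (q \<circ> p \<circ> (h \<circ> u)))"
      by (intro sum.cong refl sum.swap)
    also have "\<dots> = (\<Sum>p | p permutes T. \<Sum>q | q permutes T'.
        of_int (sign q) * (\<Sum>h\<in>?H. e (h \<circ> (q \<circ> (p \<circ> u)))))"
    proof (intro sum.cong refl)
      fix p q assume pq: "p \<in> {p. p permutes T}" "q \<in> {q. q permutes T'}"
      have "p permutes X" using pq(1) by (auto intro: permutes_subset[of p T] simp: T(3)[symmetric])
      moreover have "q permutes X" using pq(2) by (auto intro: permutes_subset[of q T'] simp: T(3)[symmetric])
      ultimately have "q \<circ> p permutes X" by (rule permutes_compose)
      from sum_single_cycles_commute[OF this, of "\<lambda>h. e (h \<circ> u)"]
      show "(\<Sum>h\<in>?H. of_int (sign q) * e (q \<circ> p \<circ> (h \<circ> u))) =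
          of_int (sign q) * (\<Sum>h\<in>?H. e (h \<circ> (q \<circ> (p \<circ> u))))"
        by (simp add: comp_assoc flip: sum_distrib_left)
    qed
    also have "\<dots> = symmetrize T (antisymmetrize T' (cycle_op (T \<union> T') e)) u"
      by (simp add: T(3) symmetrize_def antisymmetrize_def cycle_op_def comp_assoc)
    also have "\<dots> = hook_value (card X) r * f u"
      using hook_symmetrizer_cycle_op[OF T(1) T'(3) T(2)] T(3) T'(2) by (simp add: f_def)
    finally show ?thesis .
  qed
  ultimately show ?thesis using that by blast
qed

section \<open>From the cycle operator to the Cayley graph\<close>

lemma graph_eigenvalues_iff:
  assumes "finite (pverts \<Gamma>)"
  shows "x \<in> graph_eigenvalues \<Gamma> \<longleftrightarrow>
    (\<exists>f. (\<exists>v\<in>pverts \<Gamma>. f v \<noteq> 0) \<and>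
      (\<forall>u\<in>pverts \<Gamma>. (\<Sum>v | v \<in> pverts \<Gamma> \<and> (u, v) \<in> parcs \<Gamma>. f v) = x * f u))"
proof -
  obtain vs where vs: "set vs = pverts \<Gamma>" "distinct vs"
    using finite_distinct_list[OF assms] by blast
  have "(\<Sum>v\<in>pverts \<Gamma>. (if (u, v) \<in> parcs \<Gamma> then 1 else 0) * f v) =
      (\<Sum>v | v \<in> pverts \<Gamma> \<and> (u, v) \<in> parcs \<Gamma>. f v)" for u and f :: "'a \<Rightarrow> real"
    using assms by (intro sum.mono_neutral_cong_right) auto
  then show ?thesis
    unfolding graph_eigenvalues_eq_spectrum[OF vs(2,1)] spectrum_def
    by (simp add: eigenvalue_adjacency_mat_iff[OF vs(2)] vs(1))
qed

lemma graph_lambda_top_two: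
  assumes "finite (graph_eigenvalues \<Gamma>)" "a \<in> graph_eigenvalues \<Gamma>" "b \<in> graph_eigenvalues \<Gamma>" "b < a"
    and top: "\<And>x. x \<in> graph_eigenvalues \<Gamma> \<Longrightarrow> x = a \<or> x \<le> b"
  shows "graph_lambda \<Gamma> 1 = a \<and> graph_lambda \<Gamma> 2 = b"
proof -
  let ?E = "graph_eigenvalues \<Gamma>" and ?l = "sorted_list_of_set (graph_eigenvalues \<Gamma> - {a, b})"
  have less: "x < b" if "x \<in> ?E - {a, b}" for x using top[of x] that by auto
  have "sorted_list_of_set ?E = ?l @ [b, a]"
  proof (rule sorted_distinct_set_unique)
    show "sorted (?l @ [b, a])" using assms(1,4) less by (force simp: sorted_append)
    show "distinct (?l @ [b, a])" using assms(1,4) by auto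
    show "set (sorted_list_of_set ?E) = set (?l @ [b, a])" using assms by auto
  qed auto
  then show ?thesis by (simp add: graph_lambda_def)
qed

text \<open>These two bounds compare \<open>r! (n-1-r)!\<close> with its value at \<open>r = 1\<close> and at \<open>r = 2\<close>: the product
  decreases as \<open>r\<close> moves away from the ends of \<open>{0..n-1}\<close>.\<close>

lemma fact_mult_fact_le:
  assumes "r \<ge> 1" "s \<ge> 1"
  shows "fact r * fact s \<le> (fact (r + s - 1) :: real)"
  using assms(1)
proof (induction r rule: dec_induct)
  case base
  show ?case using assms(2) by simp
next
  case (step r)
  have "fact (Suc r) * fact s = real (Suc r) * (fact r * fact s)" by simp
  also have "\<dots> \<le> real (r + s) * fact (r + s - 1)"
    by (rule mult_mono) (use step assms(2) in auto)
  also have "\<dots> = fact (Suc r + s - 1)"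
    using step(1) by (cases "r + s") auto
  finally show ?case .
qed

lemma fact_mult_fact_le_2:
  assumes "r \<ge> 2" "s \<ge> 2"
  shows "fact r * fact s \<le> (2 * fact (r + s - 2) :: real)"
  using assms(1)
proof (induction r rule: dec_induct)
  case base
  show ?case by simp
next
  case (step r)
  have "fact (Suc r) * fact s = real (Suc r) * (fact r * fact s)" by simp
  also have "\<dots> \<le> real (r + s - 1) * (2 * fact (r + s - 2))"
    by (rule mult_mono) (use step assms(2) in auto)
  also have "\<dots> = 2 * fact (Suc r + s - 2)"
  proof -
    have "Suc r + s - 2 = Suc (r + s - 2)" "r + s - 1 = Suc (r + s - 2)" using step(1) by auto
    then show ?thesis by simp
  qed
  finally show ?case .
qed

text \<open>Odd \<open>r\<close> gives a negative value. For odd \<open>n\<close> and even \<open>r\<close> the complementary number \<open>n - 1 - r\<close> is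
  even as well, so it cannot be 1; this is why the bound is smaller for odd \<open>n\<close>.\<close>

lemma hook_value_bound:
  assumes "n > 4" "r < n"
  shows "hook_value n r = fact (n - 1) \<or>
    hook_value n r \<le> (if even n then fact (n - 2) else 2 * fact (n - 3))"
proof (cases "odd r")
  case True
  then show ?thesis by (auto simp: hook_value_def intro: order_trans[of _ 0])
next
  case False
  then have hv: "hook_value n r = fact r * fact (n - 1 - r)" by (simp add: hook_value_def)
  show ?thesis
  proof (cases "r = 0 \<or> r = n - 1")
    case True
    then show ?thesis using hv by auto
  next
    case inner: False
    then have r: "2 \<le> r" "r + 1 < n" using assms(2) \<open>\<not> odd r\<close> by (auto elim!: evenE)
    show ?thesis
    proof (cases "even n")
      case True
      then show ?thesis using r hv fact_mult_fact_le[of r "n - 1 - r"] by (simp add: numeral_2_eq_2)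
    next
      case False
      then have "n - 1 - r \<noteq> 1" using r \<open>\<not> odd r\<close> by presburger
      then have "2 \<le> n - 1 - r" using r by linarith
      then have "hook_value n r \<le> 2 * fact (r + (n - 1 - r) - 2)"
        unfolding hv by (rule fact_mult_fact_le_2[OF r(1)])
      moreover have "r + (n - 1 - r) - 2 = n - 3" using r by linarith
      ultimately show ?thesis using False by simp
    qed
  qed
qed

text \<open>A neighbour \<open>v\<close> of \<open>u\<close> satisfies \<open>u \<circ> v\<^sup>-\<^sup>1 \<in> H\<close>, and since \<open>H\<close> is closed under inverses this means
  \<open>v = h \<circ> u\<close> with \<open>h \<in> H\<close>.\<close>

lemma cayley_neighbour_sum:
  fixes f :: "(nat \<Rightarrow> nat) \<Rightarrow> real"
  assumes G: "G = (if even n then sym_group n else alt_group n)"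
    and n: "n > 4" and u: "u \<in> carrier G"
  shows "(\<Sum>v | v \<in> carrier G \<and> (u, v) \<in> parcs (Cay G (k_cycles n n)). f v) =
    (\<Sum>h\<in>k_cycles n n. f (h \<circ> u))"
proof -
  have mem: "v \<in> carrier G \<longleftrightarrow> v permutes {1..n} \<and> (odd n \<longrightarrow> evenperm v)" for v
    by (simp add: G sym_group_carrier alt_group_carrier)
  have mult: "mult G = (\<circ>)" by (simp add: G sym_group_mult alt_group_mult)
  have m_inv: "inv\<^bsub>G\<^esub> v = inv' v" if "v \<in> carrier G" for v
    using that G alt_group_inv_equality[of v n] by (auto split: if_splits)
  have u': "u permutes {1..n}" using u mem by blast
  show ?thesis
  proof (rule sum.reindex_bij_witness[of _ "\<lambda>h. h \<circ> u" "\<lambda>v. v \<circ> inv' u"])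
    show "v \<circ> inv' u \<circ> u = v" for v by (simp add: comp_assoc permutes_inv_o[OF u'])
    show "h \<circ> u \<circ> inv' u = h" for h by (simp add: comp_assoc permutes_inv_o[OF u'])
    show "f (v \<circ> inv' u \<circ> u) = f v" for v by (simp add: comp_assoc permutes_inv_o[OF u'])
  next
    fix v assume "v \<in> {v. v \<in> carrier G \<and> (u, v) \<in> parcs (Cay G (k_cycles n n))}"
    then have v: "v \<in> carrier G" "u \<circ> inv' v \<in> k_cycles n n"
      by (auto simp: Cay_def mult m_inv)
    then have "v permutes {1..n}" using mem by blast
    then have "inv' (u \<circ> inv' v) = v \<circ> inv' u"
      using o_inv_distrib[OF permutes_bij[OF u'] permutes_bij[OF permutes_inv]] permutes_inv_inv by metis
    then show "v \<circ> inv' u \<in> k_cycles n n" using k_cycles_inv[OF v(2)] by simp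
  next
    fix h assume h: "h \<in> k_cycles n n"
    then have h': "h permutes {1..n}" by (rule k_cycles_permutes)
    have perm: "permutation h" "permutation u" using h' u' by (auto simp: permutation_permutes)
    have "odd n \<longrightarrow> evenperm h" using k_cycles_even[OF h] n by simp
    then have hu: "h \<circ> u \<in> carrier G"
      using u permutes_compose[OF u' h'] unfolding mem by (simp add: evenperm_comp[OF perm])
    have "u \<circ> inv' (h \<circ> u) = inv' h"
      using u' h' by (simp add: o_inv_distrib permutes_bij comp_assoc[symmetric] permutes_inv_o)
    then show "h \<circ> u \<in> {v. v \<in> carrier G \<and> (u, v) \<in> parcs (Cay G (k_cycles n n))}"
      using hu u k_cycles_inv[OF h] by (simp add: Cay_def mult m_inv)
  qed
qed

theorem theorem1p1:
  fixes n :: nat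
  assumes "n > 4"
  defines "G \<equiv> (if even n then sym_group n else alt_group n)"
  defines "\<Gamma> \<equiv> Cay G (k_cycles n n)"
  shows "graph_lambda \<Gamma> 1 = fact (n - 1) \<and>
    (even n \<longrightarrow> graph_lambda \<Gamma> 2 = fact (n - 2)) \<and>
    (odd n \<longrightarrow> graph_lambda \<Gamma> 2 = 2 * fact (n - 3))"
proof -
  let ?X = "{1..n}" and ?E = "graph_eigenvalues \<Gamma>"
  have H: "k_cycles n n = single_cycles ?X" using assms(1) by (intro k_cycles_eq_single_cycles) simp
  have mem: "v \<in> carrier G \<longleftrightarrow> v permutes ?X \<and> (odd n \<longrightarrow> evenperm v)" for v
    by (simp add: G_def sym_group_carrier alt_group_carrier)
  have fin: "finite (carrier G)"
    by (rule finite_subset[OF _ finite_permutations[of ?X]]) (auto simp: mem)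
  have verts: "pverts \<Gamma> = carrier G" by (simp add: \<Gamma>_def Cay_def)
  have "(\<Sum>v | v \<in> carrier G \<and> (u, v) \<in> parcs \<Gamma>. f v) = cycle_op ?X f u" if "u \<in> carrier G" for f u
    unfolding \<Gamma>_def cycle_op_def H[symmetric]
    by (rule cayley_neighbour_sum[OF _ assms(1) that]) (simp add: G_def)
  then have eigen: "x \<in> ?E \<longleftrightarrow>
      (\<exists>f. (\<exists>v\<in>carrier G. f v \<noteq> 0) \<and> (\<forall>u\<in>carrier G. cycle_op ?X f u = x * f u))" for x
    by (simp add: graph_eigenvalues_iff verts fin)
  have comp_mem: "h \<circ> u \<in> carrier G \<longleftrightarrow> u \<in> carrier G" if "h \<in> single_cycles ?X" for h u
  proof -
    have h: "h permutes ?X" using that by (rule single_cycles_permutes)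
    have "odd n \<longrightarrow> evenperm h" using that k_cycles_even[of h n n] assms(1) by (simp add: H)
    moreover have "h \<circ> u permutes ?X \<longleftrightarrow> u permutes ?X"
    proof
      assume "h \<circ> u permutes ?X"
      then have "inv' h \<circ> (h \<circ> u) permutes ?X" by (rule permutes_compose) (rule permutes_inv[OF h])
      moreover have "inv' h \<circ> (h \<circ> u) = u" by (simp add: fun_eq_iff permutes_inverses[OF h])
      ultimately show "u permutes ?X" by simp
    qed (rule permutes_compose[OF _ h])
    moreover have "evenperm (h \<circ> u) = (evenperm h = evenperm u)" if "u permutes ?X"
      using h that by (intro evenperm_comp) (auto simp: permutation_permutes)
    ultimately show ?thesis unfolding mem by blast
  qed
  have upper: "x = fact (n - 1) \<or> x \<le> (if even n then fact (n - 2) else 2 * fact (n - 3))"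
    if xE: "x \<in> ?E" for x
  proof (cases "x = 0")
    case False
    obtain f v where f: "v \<in> carrier G" "f v \<noteq> 0" "\<And>u. u \<in> carrier G \<Longrightarrow> cycle_op ?X f u = x * f u"
      using iffD1[OF eigen xE] by blast
    \<comment> \<open>Extension by zero: \<open>h \<circ> u\<close> lies in \<open>G\<close> exactly when \<open>u\<close> does.\<close>
    define f' where "f' u = (if u \<in> carrier G then f u else 0)" for u
    have "cycle_op ?X f' = (\<lambda>u. x * f' u)"
    proof
      fix u
      show "cycle_op ?X f' u = x * f' u"
        using f(3)[of u] by (cases "u \<in> carrier G") (simp_all add: cycle_op_def f'_def comp_mem)
    qed
    moreover have "f' v \<noteq> 0" using f(1,2) by (simp add: f'_def)
    ultimately obtain r where "r < n" "x = hook_value n r"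
      using cycle_op_eigenvalue[of ?X f' x v] False assms(1) by auto
    then show ?thesis using hook_value_bound assms(1) by blast
  qed simp
  have mem_hook: "hook_value n r \<in> ?E" if rn: "r < n" for r
  proof -
    obtain f where "f id \<noteq> 0" "cycle_op ?X f = (\<lambda>u. hook_value n r * f u)"
      using cycle_op_eigenfunction[of ?X r] rn by auto
    moreover have "id \<in> carrier G" by (simp add: mem permutes_id)
    ultimately show ?thesis unfolding eigen by auto
  qed
  have "fact (n - 1) \<in> ?E" using mem_hook[of 0] assms(1) by (simp add: hook_value_def)
  moreover have "(if even n then fact (n - 2) else 2 * fact (n - 3)) \<in> ?E"
  proof (cases "even n")
    case True
    then show ?thesis using mem_hook[of "n - 2"] assms(1) by (simp add: hook_value_def)
  next
    case False
    then show ?thesis using mem_hook[of 2] assms(1) by (simp add: hook_value_def numeral_3_eq_3)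
  qed
  moreover have "(if even n then fact (n - 2) else 2 * fact (n - 3)) < (fact (n - 1) :: real)"
  proof -
    have "n - 2 = Suc (n - 3)" using assms(1) by simp
    then have "fact (n - 2) = real (n - 2) * fact (n - 3)" by (metis fact_Suc)
    moreover have "2 * fact (n - 3) \<le> real (n - 2) * fact (n - 3)"
      using assms(1) by (intro mult_right_mono) auto
    ultimately have "2 * fact (n - 3) \<le> (fact (n - 2) :: real)" by linarith
    moreover have "fact (n - 2) < (fact (n - 1) :: real)"
      using assms(1) by (intro fact_less_mono) auto
    ultimately show ?thesis by (auto intro: le_less_trans)
  qed
  moreover have "finite ?E" using fin by (intro finite_graph_eigenvalues) (simp add: verts)
  ultimately show ?thesis
    using graph_lambda_top_two[of \<Gamma> "fact (n - 1)" "if even n then fact (n - 2) else 2 * fact (n - 3)"] upper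
    by (auto split: if_splits)
qed

end
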